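(* Define functions $\hat h_{k+1},\hat h_k,\dots,\hat h_1$ of $c\in\mathbb R$ by $\hat h_{k+1}(c)=-\infty$ for $c<0$, $\hat h_{k+1}(c)=0$ for $c\ge0$, and recursively for $i=k,\dots,1$ $$\hat h_i(c)=\max_{0\le Y\le 1}\ \mathbf E_{v_i\sim f_i}\big[\hat h_{i+1}\big(Y(v_i-\mathbf E[v_i])+c\big)\big]+Y\,\mathbf E[v_i],$$ and let $Y_i^c$ be an optimizer. Let $c_0$ be a maximizer of $c\mapsto\hat h_1(c)-c$. Consider the following two mechanisms. Mechanism 1: on each day $i$, ignore the history and offer item $i$ at an optimal monopoly price for $F_i$ (a price $p$ maximizing $p\,(1-F_i(p))$). Mechanism 2: on each day $i$, the buyer reports $v_i$, is allocated item $i$ with probability $Y_i^{c_{i-1}}$, and pays $v_iY_i^{c_{i-1}}$ if $i<k$, or $Y_i^{c_{i-1}}\mathbf E[v_i]-c_{i-1}$ if $i=k$; then set $c_i=Y_i^{c_{i-1}}(v_i-\mathbf E[v_i])+c_{i-1}$. Then running each of the two mechanisms with probability one half gives a 2-approximation to the optimal revenue, i.e. its expected revenue is at least half of the optimal value of the original problem.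
   Context: Setting. Fix $k\ge 1$. A seller sells items $1,\dots,k$ to a single buyer over $k$ days. The buyer's value for item $i$ is $v_i\in[\underline v_i,\bar v_i]$ with $0\le \underline v_i<\bar v_i<\infty$, drawn independently of the other values from a distribution with density $f_i$ with support $[\underline v_i,\bar v_i]$ and cumulative distribution function $F_i$; $v_i$ is learned by the buyer at the beginning of day $i$. Write $v_{\le i}=(v_1,\dots,v_i)$, $v_{<i}=(v_1,\dots,v_{i-1})$; $(v_{\le j},v_i')$ is $v_{\le j}$ with its $i$-th entry replaced by $v_i'$. A mechanism is a sequence of (measurable) functions $x_i(v_{\le i})\in[0,1]$ (allocation probability) and $p_i(v_{\le i})\in\mathbb R$ (payment), $i=1,\dots,k$. Original problem: maximize the revenue $\mathbf E[\sum_{i=1}^k p_i(v_{\le i})]$ subject to (periodic incentive compatibility) for all $i$, $v_{\le i}$, $v_i'$: $v_ix_i(v_{\le i})-p_i(v_{\le i})+\mathbf E_{v_{i+1},\dots,v_k}[\sum_{j>i}(v_jx_j(v_{\le j})-p_j(v_{\le j}))]\ \ge\ v_ix_i(v_{<i},v_i')-p_i(v_{<i},v_i')+\mathbf E_{v_{i+1},\dots,v_k}[\sum_{j>i}(v_jx_j(v_{\le j},v_i')-p_j(v_{\le j},v_i'))]$; (ex-post individual rationality) $v_ix_i(v_{\le i})-p_i(v_{\le i})\ge 0$ for all $i$, $v_{\le i}$. *)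

theory Defs
  imports "HOL-Probability.Probability"
begin

text \<open>
  Expectation with values in the extended reals.  For mechanisms that are ex-post individually
  rational, and in the recursion for \<open>hhat\<close>, the positive or the negative part always has finite
  integral, so the value of \<open>\<infinity> - \<infinity>\<close> is immaterial.  Extended values are needed because
  \<open>hhat\<close> below takes the value \<open>-\<infinity>\<close>, and because payments are not assumed to be integrable:
  under ex-post individual rationality they are bounded above, but a conditional expected utility
  may be \<open>\<infinity>\<close> and a revenue may be \<open>-\<infinity>\<close> (the Bochner integral would silently return 0).
\<close>

definition expect :: "'a measure \<Rightarrow> ('a \<Rightarrow> ereal) \<Rightarrow> ereal" where
  "expect M g = enn2ereal (\<integral>\<^sup>+ x. e2ennreal (g x) \<partial>M) - enn2ereal (\<integral>\<^sup>+ x. e2ennreal (- g x) \<partial>M)"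

definition measure_support :: "real measure \<Rightarrow> real set" where
  "measure_support M = {x. \<forall>U. open U \<longrightarrow> x \<in> U \<longrightarrow> emeasure M U > 0}"

definition prior :: "(nat \<Rightarrow> real \<Rightarrow> real) \<Rightarrow> nat \<Rightarrow> real measure" where
  "prior f i = density lborel (\<lambda>v. ennreal (f i v))"

definition mean :: "real measure \<Rightarrow> real" where
  "mean D = (\<integral>v. v \<partial>D)"


text \<open>
  A history of reports up to day \<open>i\<close> is an extensional function on \<open>{1..i}\<close>.  A mechanism is given
  by \<open>x\<close> and \<open>p\<close>, where \<open>x i\<close> and \<open>p i\<close> are applied to histories up to day \<open>i\<close> only.
\<close>

definition histories :: "(nat \<Rightarrow> real) \<Rightarrow> (nat \<Rightarrow> real) \<Rightarrow> nat \<Rightarrow> (nat \<Rightarrow> real) set" where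
  "histories lo hi i = (\<Pi>\<^sub>E j\<in>{1..i}. {lo j..hi j})"

type_synonym policy = "nat \<Rightarrow> (nat \<Rightarrow> real) \<Rightarrow> real"

definition is_mechanism ::
    "nat \<Rightarrow> (nat \<Rightarrow> real) \<Rightarrow> (nat \<Rightarrow> real) \<Rightarrow> policy \<Rightarrow> policy \<Rightarrow> bool" where
  "is_mechanism k lo hi x p \<longleftrightarrow>
     (\<forall>i\<in>{1..k}.
        x i \<in> borel_measurable (restrict_space (\<Pi>\<^sub>M j\<in>{1..i}. borel) (histories lo hi i)) \<and>
        p i \<in> borel_measurable (restrict_space (\<Pi>\<^sub>M j\<in>{1..i}. borel) (histories lo hi i)) \<and>
        (\<forall>v\<in>histories lo hi i. x i v \<in> {0..1}))"

text \<open>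
  The buyer's expected utility from days \<open>i+1, \<dots>, k\<close> when the reports up to day \<open>i\<close> are \<open>v\<close> and
  later reports are truthful.
\<close>

definition continuation ::
    "nat \<Rightarrow> (nat \<Rightarrow> real \<Rightarrow> real) \<Rightarrow> policy \<Rightarrow> policy \<Rightarrow> nat \<Rightarrow> (nat \<Rightarrow> real) \<Rightarrow> ereal" where
  "continuation k f x p i v =
     expect (\<Pi>\<^sub>M j\<in>{i<..k}. prior f j)
       (\<lambda>w. ereal (\<Sum>j\<in>{i<..k}.
          w j * x j (restrict (merge {1..i} {i<..k} (v, w)) {1..j})
              - p j (restrict (merge {1..i} {i<..k} (v, w)) {1..j})))"

definition periodic_IC ::
    "nat \<Rightarrow> (nat \<Rightarrow> real) \<Rightarrow> (nat \<Rightarrow> real) \<Rightarrow> (nat \<Rightarrow> real \<Rightarrow> real) \<Rightarrow> policy \<Rightarrow> policy \<Rightarrow> bool" where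
  "periodic_IC k lo hi f x p \<longleftrightarrow>
     (\<forall>i\<in>{1..k}. \<forall>v\<in>histories lo hi i. \<forall>v'\<in>{lo i..hi i}.
        ereal (v i * x i v - p i v) + continuation k f x p i v
        \<ge> ereal (v i * x i (v(i := v')) - p i (v(i := v'))) + continuation k f x p i (v(i := v')))"

definition ex_post_IR ::
    "nat \<Rightarrow> (nat \<Rightarrow> real) \<Rightarrow> (nat \<Rightarrow> real) \<Rightarrow> policy \<Rightarrow> policy \<Rightarrow> bool" where
  "ex_post_IR k lo hi x p \<longleftrightarrow>
     (\<forall>i\<in>{1..k}. \<forall>v\<in>histories lo hi i. v i * x i v - p i v \<ge> 0)"

definition feasible ::
    "nat \<Rightarrow> (nat \<Rightarrow> real) \<Rightarrow> (nat \<Rightarrow> real) \<Rightarrow> (nat \<Rightarrow> real \<Rightarrow> real) \<Rightarrow> policy \<Rightarrow> policy \<Rightarrow> bool" where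
  "feasible k lo hi f x p \<longleftrightarrow>
     is_mechanism k lo hi x p \<and> periodic_IC k lo hi f x p \<and> ex_post_IR k lo hi x p"

definition revenue :: "nat \<Rightarrow> (nat \<Rightarrow> real \<Rightarrow> real) \<Rightarrow> policy \<Rightarrow> ereal" where
  "revenue k f p =
     expect (\<Pi>\<^sub>M i\<in>{1..k}. prior f i) (\<lambda>v. ereal (\<Sum>i\<in>{1..k}. p i (restrict v {1..i})))"

definition optimal_revenue ::
    "nat \<Rightarrow> (nat \<Rightarrow> real) \<Rightarrow> (nat \<Rightarrow> real) \<Rightarrow> (nat \<Rightarrow> real \<Rightarrow> real) \<Rightarrow> ereal" where
  "optimal_revenue k lo hi f = (SUP (x, p) \<in> {(x, p). feasible k lo hi f x p}. revenue k f p)"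


text \<open>
  The objective maximized over \<open>Y\<close> in the recursion, for a day with value distribution \<open>D\<close> and
  next-day function \<open>h\<close>.  The maximum in the recursion is written as a supremum.
\<close>

definition stage_objective :: "real measure \<Rightarrow> (real \<Rightarrow> ereal) \<Rightarrow> real \<Rightarrow> real \<Rightarrow> ereal" where
  "stage_objective D h c Y = expect D (\<lambda>v. h (Y * (v - mean D) + c)) + ereal (Y * mean D)"

function hhat :: "nat \<Rightarrow> (nat \<Rightarrow> real \<Rightarrow> real) \<Rightarrow> nat \<Rightarrow> real \<Rightarrow> ereal" where
  "hhat k f i =
     (if i > k then (\<lambda>c. if c < 0 then -\<infinity> else 0)
      else (\<lambda>c. SUP Y\<in>{0..1}. stage_objective (prior f i) (hhat k f (Suc i)) c Y))"
  by pat_completeness auto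
termination
  by (relation "Wellfounded.measure (\<lambda>(k, f, i). Suc k - i)") auto

declare hhat.simps [simp del]

definition is_stage_optimizer ::
    "nat \<Rightarrow> (nat \<Rightarrow> real \<Rightarrow> real) \<Rightarrow> nat \<Rightarrow> real \<Rightarrow> real \<Rightarrow> bool" where
  "is_stage_optimizer k f i c y \<longleftrightarrow>
     y \<in> {0..1} \<and>
     (\<forall>z\<in>{0..1}. stage_objective (prior f i) (hhat k f (Suc i)) c z
                  \<le> stage_objective (prior f i) (hhat k f (Suc i)) c y)"

definition is_monopoly_price :: "real measure \<Rightarrow> real \<Rightarrow> bool" where
  "is_monopoly_price D q \<longleftrightarrow> (\<forall>r. r * (1 - cdf D r) \<le> q * (1 - cdf D q))"


definition posted_alloc :: "(nat \<Rightarrow> real) \<Rightarrow> policy" where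
  "posted_alloc q i v = (if v i \<ge> q i then 1 else 0)"

definition posted_payment :: "(nat \<Rightarrow> real) \<Rightarrow> policy" where
  "posted_payment q i v = (if v i \<ge> q i then q i else 0)"


text \<open>\<open>balance f Y c0 i v\<close> is the number \<open>c\<^sub>i\<close> reached after the reports \<open>v 1, \<dots>, v i\<close>.\<close>

primrec balance ::
    "(nat \<Rightarrow> real \<Rightarrow> real) \<Rightarrow> (nat \<Rightarrow> real \<Rightarrow> real) \<Rightarrow> real \<Rightarrow> nat \<Rightarrow> (nat \<Rightarrow> real) \<Rightarrow> real" where
  "balance f Y c0 0 v = c0"
| "balance f Y c0 (Suc i) v =
     Y (Suc i) (balance f Y c0 i v) * (v (Suc i) - mean (prior f (Suc i))) + balance f Y c0 i v"

definition balance_alloc ::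
    "(nat \<Rightarrow> real \<Rightarrow> real) \<Rightarrow> (nat \<Rightarrow> real \<Rightarrow> real) \<Rightarrow> real \<Rightarrow> policy" where
  "balance_alloc f Y c0 i v = Y i (balance f Y c0 (i - 1) v)"

definition balance_payment ::
    "nat \<Rightarrow> (nat \<Rightarrow> real \<Rightarrow> real) \<Rightarrow> (nat \<Rightarrow> real \<Rightarrow> real) \<Rightarrow> real \<Rightarrow> policy" where
  "balance_payment k f Y c0 i v =
     (let c = balance f Y c0 (i - 1) v in
      if i < k then v i * Y i c else Y i c * mean (prior f i) - c)"

end

theory Submission
  imports Defs
begin

text \<open>
  With \<open>c\<close> the buyer's expected utility from the remaining days, incentive compatibility on a day says
  that his total utility \<open>W\<close> is convex in that day's report with the allocation \<open>x\<close> as slope, and \<open>W\<close>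
  has mean \<open>c\<close>. Let \<open>L\<close> be the affine function with the same mean that agrees with \<open>W\<close> at the lowest
  value; its slope \<open>Y\<close> lies in \<open>[0, 1]\<close>. Myerson's argument gives \<open>E[v x] \<le> Rev + Y E[v]\<close>, where \<open>Rev\<close> is
  the monopoly revenue of the day. The functions \<open>hhat\<close> are concave where they are finite, and \<open>L\<close>
  crosses \<open>W\<close> once from above, so \<open>E[hhat(W)] \<le> E[hhat(L)]\<close>. Summing over the days from the last one,
  the sales of a feasible mechanism that leaves the buyer expected utility \<open>c\<close> are at most
  \<open>hhat\<^sub>1(c)\<close> plus the sum of the monopoly revenues. Its revenue is therefore at most that sum, which
  Mechanism 1 earns, plus \<open>max\<^sub>c (hhat\<^sub>1(c) - c)\<close>, which Mechanism 2 earns.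

  The optimizers \<open>Y\<^sub>i\<close> are arbitrary, so measurability of Mechanism 2 needs an argument: the optimizer is
  unique, hence continuous in \<open>c\<close>, outside the countably many kinks of the next-day function.
\<close>

subsection \<open>Extended expectations\<close>

text \<open>Revenue is sales minus buyer utility, and both are nonnegative: sales because values
  are, utility by ex-post rationality. Sales are bounded, so only utility can be infinite. Both are
  therefore carried as \<open>ennreal\<close> integrals, and payments of a general mechanism are
  never integrated alone.

  The value -\<infinity> of \<open>hhat\<close> at negative arguments encodes ex-post rationality:
  the balance must stay nonnegative after almost every report. The worst report is
  \<open>lo\<close>, which yields the constraint \<open>Y * (\<mu> - lo) \<le> c\<close>.

  The term \<open>Y * \<mu>\<close> of the recursion pays for the information rent: what remains of
  the sales after the rent \<open>W - W lo\<close> is removed averages at most the monopoly revenue,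
  and the rent has mean \<open>Y * (\<mu> - lo)\<close>. Myerson's bound is obtained without
  derivatives or an envelope formula: the allocation is rounded down to a multiple of
  \<open>1 / n\<close>, each layer of height \<open>1 / n\<close> is a posted price, and
  \<open>n\<close> tends to infinity.

  The factor two comes from bounding the optimum by a sum of two terms, each of which is earned by
  one of the mechanisms.\<close>

lemma expect_cong_AE:
  assumes "AE x in M. g x = h x"
  shows "expect M g = expect M h"
proof -
  have "(\<integral>\<^sup>+ x. e2ennreal (g x) \<partial>M) = (\<integral>\<^sup>+ x. e2ennreal (h x) \<partial>M)"
    "(\<integral>\<^sup>+ x. e2ennreal (- g x) \<partial>M) = (\<integral>\<^sup>+ x. e2ennreal (- h x) \<partial>M)"
    using assms by (auto intro!: nn_integral_cong_AE)
  then show ?thesis by (simp add: expect_def)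
qed

lemma expect_nonneg:
  assumes "AE x in M. 0 \<le> g x"
  shows "expect M g = enn2ereal (\<integral>\<^sup>+ x. e2ennreal (g x) \<partial>M)"
proof -
  have "(\<integral>\<^sup>+ x. e2ennreal (- g x) \<partial>M) = (\<integral>\<^sup>+ x. 0 \<partial>M)"
    using assms by (intro nn_integral_cong_AE) (auto elim!: eventually_mono simp: e2ennreal_neg)
  then show ?thesis by (simp add: expect_def zero_ennreal.rep_eq)
qed

lemma expect_integrable:
  assumes "integrable M h"
  shows "expect M (\<lambda>x. ereal (h x)) = ereal (\<integral>x. h x \<partial>M)"
proof -
  have fin: "(\<integral>\<^sup>+ x. ennreal (h x) \<partial>M) < \<infinity>" "(\<integral>\<^sup>+ x. ennreal (- h x) \<partial>M) < \<infinity>"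
    using assms real_integrable_def[of M h] by (auto simp: less_top)
  have *: "enn2ereal a = ereal (enn2real a)" if "a < \<infinity>" for a
    using that by (cases a) auto
  show ?thesis
    using fin assms by (simp add: expect_def e2ennreal_ereal * real_lebesgue_integral_def)
qed

text \<open>Finiteness of the positive part is essential: in \<open>ereal\<close> the difference
  \<infinity> - \<infinity> is \<infinity>.\<close>

lemma expect_eq_MInf:
  assumes "(\<integral>\<^sup>+ x. e2ennreal (g x) \<partial>M) < \<infinity>" "(\<integral>\<^sup>+ x. e2ennreal (- g x) \<partial>M) = \<infinity>"
  shows "expect M g = - \<infinity>"
proof -
  have "enn2ereal (\<integral>\<^sup>+ x. e2ennreal (g x) \<partial>M) \<noteq> \<infinity>"
    using assms(1) by (cases "\<integral>\<^sup>+ x. e2ennreal (g x) \<partial>M") auto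
  then show ?thesis
    using assms(2) by (cases "enn2ereal (\<integral>\<^sup>+ x. e2ennreal (g x) \<partial>M)") (auto simp: expect_def)
qed

subsection \<open>Concave functions\<close>

lemma convex_comb_between:
  fixes a b s :: real
  assumes "a \<noteq> b"
  shows "(1 - (s - a) / (b - a)) * a + (s - a) / (b - a) * b = s"
proof -
  define t where "t = (s - a) / (b - a)"
  have "t * (b - a) = s - a" using assms by (simp add: t_def)
  then have "(1 - t) * a + t * b = s" by (simp add: algebra_simps)
  then show ?thesis by (simp add: t_def)
qed

text \<open>A concave function lies above its chord. If it were strictly above at \<open>s\<close>,
  the midpoint, a convex combination of \<open>s\<close> and the endpoint on the far side of it,
  would also be strictly above, against \<open>mid\<close>.\<close>

lemma concave_chord_affine:
  fixes G :: "real \<Rightarrow> real"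
  assumes G: "concave_on {a..b} G" and ab: "a < b"
    and mid: "G a + G b \<ge> 2 * G ((a + b) / 2)" and s: "s \<in> {a..b}"
  shows "G s = G a + (G b - G a) / (b - a) * (s - a)"
proof (rule ccontr)
  define l where "l s = G a + (G b - G a) / (b - a) * (s - a)" for s
  have la: "l a = G a" and lb: "l b = G b" using ab by (auto simp: l_def)
  have lconv: "l ((1 - t) * x + t * y) = (1 - t) * l x + t * l y" for t x y
    by (simp add: l_def) algebra
  have comb: "G ((1 - t) * x + t * y) \<ge> (1 - t) * G x + t * G y"
    if "x \<in> {a..b}" "y \<in> {a..b}" "0 \<le> t" "t \<le> 1" for t x y
    using concave_onD[OF G that(3,4,1,2)] by simp
  assume "\<not> ?thesis"
  then have ne: "G s \<noteq> l s" by (simp add: l_def)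
  have "s = (1 - (s - a) / (b - a)) * a + (s - a) / (b - a) * b"
    using convex_comb_between[of a b s] ab by simp
  then have "G s \<ge> l s"
    using comb[of a b "(s - a) / (b - a)"] lconv[of "(s - a) / (b - a)" a b] la lb s ab by simp
  with ne have gt: "G s > l s" by simp
  define c where "c = (a + b) / 2"
  have lc: "l c = (G a + G b) / 2" using ab by (simp add: l_def c_def field_simps)
  have "G c \<le> l c" using lc mid by (simp add: c_def)
  then have sne: "s \<noteq> a" "s \<noteq> b" "s \<noteq> c" using gt la lb by auto
  show False
  proof (cases "s < c")
    case True
    define t where "t = (c - s) / (b - s)"
    have t: "0 \<le> t" "t < 1" using True s ab by (auto simp: t_def c_def field_simps)
    have ceq: "c = (1 - t) * s + t * b"
      using convex_comb_between[of s b c] sne by (simp add: t_def)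
    have "G c \<ge> (1 - t) * G s + t * G b"
      using comb[of s b t] t s ab ceq by simp
    moreover have "(1 - t) * G s > (1 - t) * l s" using gt t by simp
    ultimately have "G c > l c" using lconv[of t s b] ceq lb by simp
    then show False using mid lc by (simp add: c_def)
  next
    case False
    then have sc: "c < s" using sne by simp
    define t where "t = (c - a) / (s - a)"
    have t: "0 < t" "t \<le> 1" using sc s ab by (auto simp: t_def c_def field_simps)
    have ceq: "c = (1 - t) * a + t * s"
      using convex_comb_between[of a s c] sne by (simp add: t_def)
    have "G c \<ge> (1 - t) * G a + t * G s"
      using comb[of a s t] t s ab ceq by simp
    moreover have "t * G s > t * l s" using gt t by simp
    ultimately have "G c > l c" using lconv[of t a s] ceq la by simp
    then show False using mid lc by (simp add: c_def)
  qed
qed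

text \<open>The scaled intervals \<open>[\<rho> t, t]\<close> overlap, so the local slopes all agree.\<close>

lemma affine_of_affine_scales:
  fixes G :: "real \<Rightarrow> real"
  assumes T: "0 < T" and r: "0 \<le> r" "r < 1" and cont: "continuous_on {0..T} G"
    and aff: "\<And>t. 0 < t \<Longrightarrow> t \<le> T \<Longrightarrow> \<exists>a b. \<forall>s\<in>{r * t..t}. G s = a + b * s"
  shows "\<exists>b. \<forall>s\<in>{0..T}. G s = G 0 + b * s"
proof -
  obtain a b where ab: "\<And>s. s \<in> {r * T..T} \<Longrightarrow> G s = a + b * s" using aff[of T] T by blast
  \<comment> \<open>Any ratio strictly between \<open>r\<close> and 1 works. Since
    \<open>r < u\<close>, the next interval shares the nondegenerate piece from \<open>p\<close> to
    \<open>t\<close> with the region already covered, so both affine formulas agree; since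
    \<open>u < 1\<close>, the left ends tend to 0.\<close>
  define u where "u = (1 + r) / 2"
  have u: "r < u" "u < 1" "0 < u" using r by (auto simp: u_def)
  have step: "\<forall>s\<in>{r * u ^ n * T..T}. G s = a + b * s" for n
  proof (induction n)
    case 0 then show ?case using ab by simp
  next
    case (Suc n)
    define t where "t = u ^ Suc n * T"
    have un: "0 < u ^ n" "u ^ n \<le> 1" using u by (auto intro: power_le_one)
    have "u ^ Suc n \<le> 1" using u by (intro power_le_one) auto
    then have t: "0 < t" "t \<le> T" using T u by (auto simp: t_def intro: mult_left_le_one_le)
    obtain a' b' where ab': "\<And>s. s \<in> {r * t..t} \<Longrightarrow> G s = a' + b' * s" using aff[OF t] by blast
    define p where "p = r * u ^ n * T"
    have pt: "p < t" using u un T by (simp add: p_def t_def)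
    have pr: "r * t \<le> p"
    proof -
      have "r * t = u * p" by (simp add: p_def t_def)
      also have "\<dots> \<le> p" using u r T un by (intro mult_left_le_one_le) (auto simp: p_def)
      finally show ?thesis .
    qed
    have "\<forall>s\<in>{p..T}. G s = a + b * s" using Suc by (simp add: p_def)
    then have "G p = a + b * p" "G t = a + b * t" using pt t by auto
    moreover have "G p = a' + b' * p" "G t = a' + b' * t" using ab' pt pr by auto
    ultimately have "a + b * p = a' + b' * p" "a + b * t = a' + b' * t" by simp_all
    then have "(b - b') * (t - p) = 0" "a - a' = (b' - b) * p" by (auto simp: algebra_simps)
    then have eq: "b' = b" "a' = a" using pt by auto
    have "G s = a + b * s" if "s \<in> {r * u ^ Suc n * T..T}" for s
    proof (cases "s \<le> t")
      case True
      have "r * t = r * u ^ Suc n * T" by (simp add: t_def)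
      then show ?thesis using ab'[of s] that True eq by auto
    next
      case False
      then show ?thesis using Suc that pt by (auto simp: p_def)
    qed
    then show ?case by blast
  qed
  have pos: "G s = a + b * s" if "0 < s" "s \<le> T" for s
  proof -
    have "(\<lambda>n. r * u ^ n * T) \<longlonglongrightarrow> r * 0 * T"
      using u by (intro tendsto_intros LIMSEQ_power_zero) auto
    then have "eventually (\<lambda>n. r * u ^ n * T < s) sequentially"
      using that by (intro order_tendstoD(2)) auto
    then obtain n where "r * u ^ n * T < s" by (auto simp: eventually_sequentially)
    then show ?thesis using step[of n] that by auto
  qed
  \<comment> \<open>The left ends may only approach 0, so the value there comes from
    continuity.\<close>
  have "G 0 = a"
  proof -
    have l1: "(\<lambda>n. G (T / real (Suc n))) \<longlonglongrightarrow> G 0"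
    proof (rule continuous_on_tendsto_compose[OF cont])
      show "(\<lambda>n. T / real (Suc n)) \<longlonglongrightarrow> 0"
        using LIMSEQ_Suc[OF lim_const_over_n[of T]] by simp
      have "T / real (Suc n) \<le> T" for n using T by (simp add: field_simps)
      then show "\<forall>\<^sub>F n in sequentially. T / real (Suc n) \<in> {0..T}" using T by simp
    qed (use T in auto)
    have "(\<lambda>n. a + b * (T / real (Suc n))) \<longlonglongrightarrow> a + b * 0"
      using LIMSEQ_Suc[OF lim_const_over_n[of T]] by (intro tendsto_intros) simp
    moreover have "G (T / real (Suc n)) = a + b * (T / real (Suc n))" for n
      using T by (intro pos) (auto simp: field_simps)
    ultimately have "(\<lambda>n. G (T / real (Suc n))) \<longlonglongrightarrow> a" by simp
    then show ?thesis using l1 LIMSEQ_unique by blast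
  qed
  then have "G s = G 0 + b * s" if "s \<in> {0..T}" for s
    using pos[of s] that by (cases "s = 0") auto
  then show ?thesis by blast
qed

text \<open>A real-valued stand-in for \<open>hhat\<close>: the value -\<infinity> on negative
  arguments is replaced by 0, which gives a function continuous on the whole line. Concavity is then
  only available on nonnegative arguments. The linear bound controls the slope at 0 and makes the
  class closed under the stage operator, with a larger \<open>K\<close>.\<close>

definition stage_fun :: "real \<Rightarrow> (real \<Rightarrow> real) \<Rightarrow> bool" where
  "stage_fun K g \<longleftrightarrow> 0 \<le> K \<and> concave_on {0..} g \<and> mono g \<and> (\<forall>c\<le>0. g c = 0) \<and> (\<forall>c\<ge>0. g c \<le> K * c)"

lemma stage_fun_nonneg: "stage_fun K g \<Longrightarrow> 0 \<le> g c"
  unfolding stage_fun_def mono_def by (metis linear order_refl)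

text \<open>By concavity and \<open>g 0 = 0\<close>, the secant slope over \<open>[a, b]\<close>
  with \<open>0 < a\<close> is at most \<open>g b / b\<close>, hence at most \<open>K\<close>.
  Monotonicity gives the other sign.\<close>

lemma stage_fun_Lipschitz:
  assumes "stage_fun K g"
  shows "\<bar>g a - g b\<bar> \<le> K * \<bar>a - b\<bar>"
proof -
  have main: "g b - g a \<le> K * (b - a)" "g a \<le> g b" if "a \<le> b" for a b
  proof -
    have K: "0 \<le> K" and mono: "mono g" and z: "\<And>c. c \<le> 0 \<Longrightarrow> g c = 0"
      and le: "\<And>c. 0 \<le> c \<Longrightarrow> g c \<le> K * c" and conc: "concave_on {0..} g"
      using assms by (auto simp: stage_fun_def)
    show "g a \<le> g b" using mono that by (rule monoD)
    have "b \<le> 0 \<or> a \<le> 0 \<and> 0 \<le> b \<or> 0 < a \<and> a < b \<or> a = b" using that by linarith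
    then consider "b \<le> 0" | "a \<le> 0" "0 \<le> b" | "0 < a" "a < b" | "a = b" by blast
    then show "g b - g a \<le> K * (b - a)"
    proof cases
      case 1 then show ?thesis using z that K by simp
    next
      case 2
      have "K * b \<le> K * (b - a)" using K 2 by (intro mult_left_mono) auto
      then show ?thesis using le[of b] z[of a] 2 by simp
    next
      case 3
      define t where "t = a / b"
      have t: "0 \<le> t" "t \<le> 1" and a: "a = t * b" using 3 by (auto simp: t_def)
      have "g a \<ge> t * g b"
        using concave_onD[OF conc t, of 0 b] 3 z[of 0] a by simp
      then have "g b - g a \<le> (1 - t) * g b" by (simp add: algebra_simps)
      also have "\<dots> \<le> (1 - t) * (K * b)" using le[of b] 3 t by (intro mult_left_mono) auto
      also have "\<dots> = K * (b - a)" by (simp add: a algebra_simps)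
      finally show ?thesis .
    qed auto
  qed
  show ?thesis using main[of a b] main[of b a] by (cases "a \<le> b") auto
qed

lemma stage_fun_continuous: "stage_fun K g \<Longrightarrow> continuous_on S g"
proof -
  assume g: "stage_fun K g"
  have "K-lipschitz_on UNIV g"
    using stage_fun_Lipschitz[OF g] g by (intro lipschitz_onI) (auto simp: dist_real_def stage_fun_def)
  then show ?thesis using lipschitz_on_continuous_on continuous_on_subset by blast
qed

lemma stage_fun_measurable [measurable_dest]: "stage_fun K g \<Longrightarrow> g \<in> borel_measurable borel"
  by (simp add: borel_measurable_continuous_onI stage_fun_continuous)

lemma stage_fun_concaveD:
  assumes "stage_fun K g" "0 \<le> t" "t \<le> 1" "0 \<le> x" "0 \<le> y"
  shows "(1 - t) * g x + t * g y \<le> g ((1 - t) * x + t * y)"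
  using assms concave_onD[of "{0..}" g t x y] by (simp add: stage_fun_def)

text \<open>At interior points this is the subgradient of a convex function; at the endpoint 0 the
  slope \<open>K\<close> of the linear bound serves.\<close>

lemma stage_fun_supergradient:
  assumes g: "stage_fun K g" and l: "0 \<le> l"
  shows "\<exists>s. \<forall>y\<ge>0. g y \<le> g l + s * (y - l)"
proof (cases "l = 0")
  case True
  then show ?thesis using g by (intro exI[of _ K]) (auto simp: stage_fun_def)
next
  case False
  have conv: "convex_on {0..} (\<lambda>x. - g x)" using g by (simp add: stage_fun_def concave_on_def)
  have int: "l \<in> interior {0..}" using l False by (simp add: interior_real_atLeast)
  define S where "S = Inf ((\<lambda>t. (- g l - - g t) / (l - t)) ` ({l<..} \<inter> {0..}))"
  have "- g y \<ge> - g l + S * (y - l)" if "0 \<le> y" for y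
    using convex_le_Inf_differential[OF conv int, of y] that by (simp add: S_def)
  then have "\<forall>y\<ge>0. g y \<le> g l + - S * (y - l)" by force
  then show ?thesis by (rule exI)
qed

text \<open>Secant slopes of a concave function decrease, so those to the left of \<open>l\<close>
  are at least \<open>s\<close>; the next lemma is the mirror image. Both compare \<open>g\<close>
  at two points on the same side of \<open>l\<close>, as the crossing argument requires.\<close>

lemma stage_fun_supergradient_below:
  assumes g: "stage_fun K g" and s: "\<And>y. 0 \<le> y \<Longrightarrow> g y \<le> g l + s * (y - l)"
    and ab: "0 \<le> a" "a \<le> b" "b \<le> l"
  shows "s * (b - a) \<le> g b - g a"
proof (cases "a = l")
  case True
  then show ?thesis using ab by simp
next
  case False
  then have al: "a < l" using ab by simp
  define t where "t = (b - a) / (l - a)"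
  have t: "0 \<le> t" "t \<le> 1" and b: "b = (1 - t) * a + t * l"
    using al ab convex_comb_between[of a l b] by (auto simp: t_def)
  have "(1 - t) * g a + t * g l \<le> g b"
    using stage_fun_concaveD[OF g t, of a l] ab b by simp
  moreover have "t * (s * (l - a)) \<le> t * (g l - g a)"
    using s[of a] ab t by (intro mult_left_mono) (auto simp: algebra_simps)
  moreover have "t * (s * (l - a)) = s * (b - a)" using al by (simp add: t_def)
  ultimately show ?thesis by (simp add: algebra_simps)
qed

lemma stage_fun_supergradient_above:
  assumes g: "stage_fun K g" and s: "\<And>y. 0 \<le> y \<Longrightarrow> g y \<le> g l + s * (y - l)"
    and ab: "0 \<le> l" "l \<le> a" "a \<le> b"
  shows "g b - g a \<le> s * (b - a)"
proof (cases "b = l")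
  case True
  then show ?thesis using ab by simp
next
  case False
  then have al: "l < b" using ab by simp
  define t where "t = (a - l) / (b - l)"
  have t: "0 \<le> t" "t \<le> 1" and b: "a = (1 - t) * l + t * b"
    using al ab convex_comb_between[of l b a] by (auto simp: t_def)
  have "(1 - t) * g l + t * g b \<le> g a"
    using stage_fun_concaveD[OF g t, of l b] ab b by simp
  moreover have "(1 - t) * (g b - g l) \<le> (1 - t) * (s * (b - l))"
    using s[of b] ab t by (intro mult_left_mono) (auto simp: algebra_simps)
  moreover have "(1 - t) * (s * (b - l)) = s * (b - a)"
  proof -
    have "(1 - t) * (b - l) = b - a" using al by (simp add: t_def field_simps)
    then show ?thesis by (metis mult.left_commute)
  qed
  ultimately show ?thesis by (simp add: algebra_simps)
qed

text \<open>A strict kink at \<open>c\<close> is recorded by a rational slope \<open>r\<close> for which \<open>c\<close> is the only maximizer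
  of \<open>g y - r * y\<close>; distinct kinks have distinct slopes.\<close>

lemma countable_kinks:
  fixes g :: "real \<Rightarrow> real"
  shows "countable {c. 0 \<le> c \<and> (\<exists>r\<in>\<rat>. \<forall>y\<ge>0. y \<noteq> c \<longrightarrow> g y - r * y < g c - r * c)}"
    (is "countable ?S")
proof (rule countable_subset)
  define P where "P r c \<longleftrightarrow> 0 \<le> c \<and> (\<forall>y\<ge>0. y \<noteq> c \<longrightarrow> g y - r * y < g c - r * c)" for r c
  have the_P: "(THE c. P r c) = c" if "P r c" for r c
    using that by (intro the_equality) (auto simp: P_def, smt (verit))
  show "?S \<subseteq> (\<lambda>r. THE c. P r c) ` \<rat>"
  proof
    fix c assume "c \<in> ?S"
    then obtain r where r: "r \<in> \<rat>" "P r c" by (auto simp: P_def)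
    show "c \<in> (\<lambda>r. THE c. P r c) ` \<rat>"
      by (rule image_eqI[of _ _ r]) (simp_all only: the_P[OF r(2)] r(1))
  qed
  show "countable ((\<lambda>r::real. THE c. P r c) ` \<rat>)" by (intro countable_image countable_rat)
qed

subsection \<open>The value distribution of one day\<close>

text \<open>The density survives as \<open>atomless\<close>, which identifies the probability of
  accepting a price with \<open>1 - cdf\<close>. The exact support turns almost sure identities
  between continuous functions into pointwise ones.\<close>

locale value_dist = prob_space D for D :: "real measure" +
  fixes lo hi :: real
  assumes sets_D [measurable_cong, simp]: "sets D = sets borel"
    and lo_nonneg: "0 \<le> lo" and lo_less_hi: "lo < hi"
    and support: "measure_support D = {lo..hi}"
    and atomless: "\<And>x. emeasure D {x} = 0"
begin

definition "\<mu> = mean D"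

lemma space_D [simp]: "space D = UNIV"
  using sets_eq_imp_space_eq[OF sets_D] by simp

lemma prob_UNIV [simp]: "prob UNIV = 1"
  using prob_space by simp

text \<open>The complement of the support is a union of null open sets, and Lindelof reduces it to a
  countable union.\<close>

lemma AE_in: "AE v in D. v \<in> {lo..hi}"
proof -
  define F where "F = {U. open U \<and> emeasure D U = 0}"
  obtain F' where F': "F' \<subseteq> F" "countable F'" "\<Union>F' = \<Union>F"
    using Lindelof[of F] by (auto simp: F_def)
  have "x \<in> \<Union>F" if "x \<notin> {lo..hi}" for x
    using that unfolding support[symmetric] measure_support_def F_def by auto
  then have sub: "- {lo..hi} \<subseteq> \<Union>F'" using F' by auto
  have "\<Union>F' \<in> null_sets D"
    using F'(1,2) by (intro null_sets_UN'[of F' "\<lambda>x. x", simplified]) (auto simp: F_def null_sets_def)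
  then show ?thesis
    by (rule AE_I') (use sub in auto)
qed

lemma emeasure_open_pos: "open U \<Longrightarrow> x \<in> U \<Longrightarrow> x \<in> {lo..hi} \<Longrightarrow> 0 < emeasure D U"
  using support by (auto simp: measure_support_def)

lemma integrable_bounded:
  fixes h :: "real \<Rightarrow> real"
  assumes [measurable]: "h \<in> borel_measurable D" and "\<And>v. v \<in> {lo..hi} \<Longrightarrow> \<bar>h v\<bar> \<le> B"
  shows "integrable D h"
proof (rule integrable_const_bound[of _ B])
  show "AE v in D. norm (h v) \<le> B"
    using AE_in by eventually_elim (use assms(2) in auto)
qed measurable

lemma integrable_id [simp, intro]: "integrable D (\<lambda>v. v)"
  by (rule integrable_bounded[of _ "\<bar>lo\<bar> + \<bar>hi\<bar>"]) auto

lemma integrable_shift [simp, intro]: "integrable D (\<lambda>v. a + b * (v - c))"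
  by (intro Bochner_Integration.integrable_add integrable_mult_right Bochner_Integration.integrable_diff) auto

lemma integral_shift: "(\<integral>v. a + b * (v - c) \<partial>D) = a + b * (\<mu> - c)"
proof -
  have "(\<integral>v. a + b * (v - c) \<partial>D) = (\<integral>v. a \<partial>D) + (\<integral>v. b * (v - c) \<partial>D)"
    by (intro Bochner_Integration.integral_add) auto
  also have "(\<integral>v. b * (v - c) \<partial>D) = b * ((\<integral>v. v \<partial>D) - (\<integral>v. c \<partial>D))"
    by (simp add: Bochner_Integration.integral_diff)
  finally show ?thesis by (simp add: \<mu>_def mean_def prob_space)
qed

text \<open>A positive value would persist on a relatively open part of the interval, and an open
  set meeting the support has positive mass.\<close>

lemma continuous_nonneg_eq_0:
  fixes h :: "real \<Rightarrow> real"
  assumes cont: "continuous_on {lo..hi} h" and nonneg: "\<And>v. v \<in> {lo..hi} \<Longrightarrow> 0 \<le> h v"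
    and int: "integrable D h" "(\<integral>v. h v \<partial>D) = 0" and x: "x \<in> {lo..hi}"
  shows "h x = 0"
proof (rule ccontr)
  assume "h x \<noteq> 0"
  then have pos: "0 < h x" using nonneg[OF x] by simp
  have "AE v in D. 0 \<le> h v" using AE_in by (rule eventually_mono) (rule nonneg)
  then have "AE v in D. h v = 0" using int integral_nonneg_eq_0_iff_AE by blast
  then have AE: "AE v in D. h v = 0 \<and> v \<in> {lo..hi}" using AE_in by eventually_elim auto
  have "open {0 :: real<..}" by simp
  then obtain U where U: "open U" "U \<inter> {lo..hi} = h -` {0<..} \<inter> {lo..hi}"
    using cont[unfolded continuous_on_open_invariant] by blast
  have "AE v in D. v \<notin> U" using AE by eventually_elim (use U(2) in \<open>metis IntI IntD1 vimage_eq greaterThan_iff less_irrefl\<close>)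
  then have "emeasure D U = 0"
    using U(1) by (subst (asm) AE_iff_measurable[of U]) auto
  moreover have "x \<in> U" using U(2) pos x by (metis IntI IntD1 vimage_eq greaterThan_iff)
  ultimately show False using emeasure_open_pos[OF U(1), of x] x by simp
qed

text \<open>Strictness matters: \<open>\<mu> - lo\<close> occurs as a denominator, and later
  arguments need room on both sides of the mean.\<close>

lemma mean_bounds: "lo < \<mu>" "\<mu> < hi"
proof -
  have i: "(\<integral>v. 0 + 1 * (v - lo) \<partial>D) = \<mu> - lo" "(\<integral>v. hi + -1 * (v - 0) \<partial>D) = hi - \<mu>"
    by (subst integral_shift, simp)+
  have "0 \<le> (\<integral>v. 0 + 1 * (v - lo) \<partial>D)" "0 \<le> (\<integral>v. hi + -1 * (v - 0) \<partial>D)"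
    by (rule integral_nonneg_AE, use AE_in in eventually_elim, simp)+
  moreover have "(\<integral>v. 0 + 1 * (v - lo) \<partial>D) \<noteq> 0"
    using continuous_nonneg_eq_0[of "\<lambda>v. 0 + 1 * (v - lo)" hi] lo_less_hi
    by (fastforce intro!: continuous_intros integrable_shift)
  moreover have "(\<integral>v. hi + -1 * (v - 0) \<partial>D) \<noteq> 0"
    using continuous_nonneg_eq_0[of "\<lambda>v. hi + -1 * (v - 0)" lo] lo_less_hi
    by (fastforce intro!: continuous_intros integrable_shift)
  ultimately show "lo < \<mu>" "\<mu> < hi" using i by linarith+
qed

lemma mean_pos: "0 < \<mu>"
  using mean_bounds lo_nonneg by simp

lemma prob_ge_eq_cdf: "prob {r..} = 1 - cdf D r"
proof -
  have "prob {r..} = prob ({r} \<union> {r<..})" by (intro arg_cong[where f=prob]) auto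
  also have "\<dots> = prob {r} + prob {r<..}" by (intro finite_measure_Union) auto
  also have "prob {r} = 0" using atomless by (simp add: measure_def)
  also have "{r<..} = space D - {..r}" by auto
  finally show ?thesis by (subst (asm) prob_compl) (auto simp: cdf_def)
qed

lemma prob_lower_pos: "lo < r \<Longrightarrow> 0 < prob {..<r}"
  using emeasure_open_pos[of "{..<r}" lo] lo_less_hi by (simp add: emeasure_eq_measure)

subsection \<open>The stage operator\<close>

definition stage_value :: "(real \<Rightarrow> real) \<Rightarrow> real \<Rightarrow> real \<Rightarrow> real" where
  "stage_value g c Y = (\<integral>v. g (c + Y * (v - \<mu>)) \<partial>D) + Y * \<mu>"

text \<open>The last conjunct says that the balance after the lowest report,
  \<open>c + Y * (lo - \<mu>)\<close>, is nonnegative. For \<open>Y\<close> between 0 and 1 this is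
  exactly when the stage objective is finite.\<close>

definition stage_feasible :: "real \<Rightarrow> real \<Rightarrow> bool" where
  "stage_feasible c Y \<longleftrightarrow> 0 \<le> Y \<and> Y \<le> 1 \<and> Y * (\<mu> - lo) \<le> c"

lemma stage_feasible_ge_0: "stage_feasible c Y \<Longrightarrow> 0 \<le> c"
  using mean_bounds mult_nonneg_nonneg[of Y "\<mu> - lo"] unfolding stage_feasible_def by linarith

lemma stage_feasible_balance:
  "stage_feasible c Y \<Longrightarrow> v \<in> {lo..hi} \<Longrightarrow> 0 \<le> c + Y * (v - \<mu>)"
proof -
  assume Y: "stage_feasible c Y" and v: "v \<in> {lo..hi}"
  have "Y * (lo - \<mu>) \<le> Y * (v - \<mu>)" using Y v by (intro mult_left_mono) (auto simp: stage_feasible_def)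
  then show ?thesis using Y by (auto simp: stage_feasible_def algebra_simps)
qed

lemma integrable_stage:
  assumes g: "stage_fun K g"
  shows "integrable D (\<lambda>v. g (c + Y * (v - \<mu>)))"
proof (rule integrable_bounded)
  note stage_fun_measurable[OF g, measurable]
  show "(\<lambda>v. g (c + Y * (v - \<mu>))) \<in> borel_measurable D" by measurable
  fix v assume v: "v \<in> {lo..hi}"
  have K: "0 \<le> K" using g by (simp add: stage_fun_def)
  have "g 0 = 0" using g by (simp add: stage_fun_def)
  then have "\<bar>g (c + Y * (v - \<mu>))\<bar> \<le> K * \<bar>c + Y * (v - \<mu>)\<bar>"
    using stage_fun_Lipschitz[OF g, of "c + Y * (v - \<mu>)" 0] by simp
  also have "\<dots> \<le> K * (\<bar>c\<bar> + \<bar>Y\<bar> * (hi - lo))"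
  proof (intro mult_left_mono K)
    have "\<bar>Y * (v - \<mu>)\<bar> \<le> \<bar>Y\<bar> * (hi - lo)"
      unfolding abs_mult using v mean_bounds by (intro mult_left_mono) auto
    then show "\<bar>c + Y * (v - \<mu>)\<bar> \<le> \<bar>c\<bar> + \<bar>Y\<bar> * (hi - lo)" by linarith
  qed
  finally show "\<bar>g (c + Y * (v - \<mu>))\<bar> \<le> K * (\<bar>c\<bar> + \<bar>Y\<bar> * (hi - lo))" .
qed

lemma stage_objective_feasible:
  assumes g: "stage_fun K g" and h: "\<And>c. h c = (if c < 0 then - \<infinity> else ereal (g c))"
    and Y: "stage_feasible c Y"
  shows "stage_objective D h c Y = ereal (stage_value g c Y)"
proof -
  have "AE v in D. h (Y * (v - \<mu>) + c) = ereal (g (c + Y * (v - \<mu>)))"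
    using AE_in
  proof eventually_elim
    case (elim v)
    then show ?case using stage_feasible_balance[OF Y elim] by (simp add: h add.commute)
  qed
  then have "expect D (\<lambda>v. h (Y * (v - \<mu>) + c)) = ereal (\<integral>v. g (c + Y * (v - \<mu>)) \<partial>D)"
    by (simp add: expect_cong_AE expect_integrable[OF integrable_stage[OF g]])
  then show ?thesis by (simp add: stage_objective_def stage_value_def flip: \<mu>_def)
qed

text \<open>A deficit at \<open>lo\<close> persists for values slightly above \<open>lo\<close>.
  These have positive probability because \<open>lo\<close> lies in the support, and there
  \<open>h\<close> is -\<infinity>; the positive part stays integrable.\<close>

lemma stage_objective_infeasible:
  assumes g: "stage_fun K g" and h: "\<And>c. h c = (if c < 0 then - \<infinity> else ereal (g c))"
    and Y: "0 \<le> Y" "Y \<le> 1" "\<not> stage_feasible c Y"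
  shows "stage_objective D h c Y = - \<infinity>"
proof -
  note stage_fun_measurable[OF g, measurable]
  have neg: "c + Y * (lo - \<mu>) < 0" using Y by (auto simp: stage_feasible_def algebra_simps)
  have [measurable]: "h \<in> borel_measurable borel" unfolding h[abs_def] by measurable
  have "(\<integral>\<^sup>+ v. e2ennreal (h (Y * (v - \<mu>) + c)) \<partial>D) \<le> (\<integral>\<^sup>+ v. ennreal (g (c + Y * (v - \<mu>))) \<partial>D)"
    by (intro nn_integral_mono) (auto simp: h e2ennreal_ereal add.commute e2ennreal_neg)
  also have "\<dots> < \<infinity>"
    using integrable_stage[OF g, of c Y] unfolding real_integrable_def by (simp add: less_top)
  finally have fin: "(\<integral>\<^sup>+ v. e2ennreal (h (Y * (v - \<mu>) + c)) \<partial>D) < \<infinity>" .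
  have "\<exists>r>lo. \<forall>v<r. c + Y * (v - \<mu>) < 0"
  proof (intro exI conjI allI impI)
    \<comment> \<open>\<open>r\<close> exceeds \<open>lo\<close> by the size of the deficit. As
      \<open>Y \<le> 1\<close>, moving from \<open>lo\<close> to \<open>v\<close> raises the balance
      by at most \<open>v - lo\<close>, so the deficit cannot be closed before
      \<open>r\<close>.\<close>
    define r where "r = lo - (c + Y * (lo - \<mu>))"
    show "lo < r" using neg by (simp add: r_def)
    fix v assume "v < r"
    then have "Y * (v - lo) \<le> Y * (r - lo)" using Y by (intro mult_left_mono) auto
    also have "\<dots> \<le> r - lo" using Y neg by (intro mult_left_le_one_le) (auto simp: r_def)
    finally have *: "c + Y * (v - \<mu>) \<le> 0" by (simp add: r_def algebra_simps)
    show "c + Y * (v - \<mu>) < 0"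
    proof (cases "Y = 0")
      case True then show ?thesis using neg by simp
    next
      case False
      then have "Y * (v - lo) < Y * (r - lo)" using Y \<open>v < r\<close> by (intro mult_strict_left_mono) auto
      also have "\<dots> \<le> r - lo" using Y neg by (intro mult_left_le_one_le) (auto simp: r_def)
      finally show ?thesis by (simp add: r_def algebra_simps)
    qed
  qed
  then obtain r where r: "lo < r" "\<And>v. v < r \<Longrightarrow> c + Y * (v - \<mu>) < 0" by blast
  have "\<infinity> * emeasure D {..<r} = (\<integral>\<^sup>+ v. \<infinity> * indicator {..<r} v \<partial>D)"
    by (simp add: nn_integral_cmult_indicator)
  also have "\<dots> \<le> (\<integral>\<^sup>+ v. e2ennreal (- h (Y * (v - \<mu>) + c)) \<partial>D)"
    using r(2) by (intro nn_integral_mono) (auto simp: h indicator_def add.commute e2ennreal_infty)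
  finally have "(\<integral>\<^sup>+ v. e2ennreal (- h (Y * (v - \<mu>) + c)) \<partial>D) = \<infinity>"
    using prob_lower_pos[OF r(1)]
    by (simp add: emeasure_eq_measure ennreal_top_mult split: if_splits add: top.extremum_unique)
  with fin have "expect D (\<lambda>v. h (Y * (v - \<mu>) + c)) = - \<infinity>" by (rule expect_eq_MInf)
  then show ?thesis by (simp add: stage_objective_def flip: \<mu>_def)
qed

end

subsection \<open>Single-day upper bound\<close>

text \<open>\<open>W_subgradient\<close> is incentive compatibility: a buyer of value
  \<open>y\<close> who reports \<open>y'\<close> receives what type \<open>y'\<close> receives plus
  \<open>(y - y') * x y'\<close>, since the continuation depends on the report alone.\<close>

locale day_mechanism = value_dist +
  fixes x W :: "real \<Rightarrow> real"
  assumes x_measurable [measurable]: "x \<in> borel_measurable borel"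
    and W_measurable [measurable]: "W \<in> borel_measurable borel"
    and x_range: "\<And>y. y \<in> {lo..hi} \<Longrightarrow> 0 \<le> x y \<and> x y \<le> 1"
    and W_nonneg: "\<And>y. y \<in> {lo..hi} \<Longrightarrow> 0 \<le> W y"
    and W_subgradient: "\<And>y y'. y \<in> {lo..hi} \<Longrightarrow> y' \<in> {lo..hi} \<Longrightarrow> W y' + (y - y') * x y' \<le> W y"
begin

lemma x_mono: "y \<in> {lo..hi} \<Longrightarrow> y' \<in> {lo..hi} \<Longrightarrow> y' \<le> y \<Longrightarrow> x y' \<le> x y"
proof -
  assume y: "y \<in> {lo..hi}" "y' \<in> {lo..hi}" "y' \<le> y"
  have "(y - y') * x y' \<le> (y - y') * x y"
    using W_subgradient[OF y(1,2)] W_subgradient[OF y(2,1)] by (simp add: algebra_simps)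
  then show ?thesis using y(3) by (cases "y = y'") (auto simp: mult_le_cancel_left)
qed

lemma W_bounds:
  assumes "y \<in> {lo..hi}"
  shows "W lo \<le> W y" "W y \<le> W lo + (y - lo)"
proof -
  have lo: "lo \<in> {lo..hi}" using lo_less_hi by simp
  have "0 \<le> (y - lo) * x lo" using assms x_range[OF lo] by simp
  then show "W lo \<le> W y" using W_subgradient[OF assms lo] by simp
  have "(y - lo) * x y \<le> (y - lo) * 1" using assms x_range[OF assms] by (intro mult_left_mono) auto
  then show "W y \<le> W lo + (y - lo)" using W_subgradient[OF lo assms] by (simp add: algebra_simps)
qed

lemma integrable_W [simp, intro]: "integrable D W"
proof (rule integrable_bounded)
  fix v assume "v \<in> {lo..hi}"
  then show "\<bar>W v\<bar> \<le> W lo + (hi - lo)" using W_bounds[of v] W_nonneg[of v] by auto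
qed simp

lemma integrable_sales [simp, intro]: "integrable D (\<lambda>v. v * x v)"
proof (rule integrable_bounded)
  fix v assume v: "v \<in> {lo..hi}"
  then have "v * x v \<le> hi * 1" using x_range[OF v] lo_nonneg by (intro mult_mono) auto
  then show "\<bar>v * x v\<bar> \<le> hi" using v x_range[OF v] lo_nonneg by auto
qed measurable

section \<open>Myerson's bound through finitely many posted prices\<close>

definition level :: "nat \<Rightarrow> nat \<Rightarrow> real set" where
  "level n l = {y \<in> {lo..hi}. real l / real n \<le> x y}"

text \<open>The default \<open>hi + 1\<close> is a price that no value in the interval accepts, so
  an empty level sells nothing.\<close>

definition threshold :: "nat \<Rightarrow> nat \<Rightarrow> real" where
  "threshold n l = (if level n l = {} then hi + 1 else Inf (level n l))"

lemma bdd_below_level: "bdd_below (level n l)"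
  by (rule bdd_belowI[of _ lo]) (auto simp: level_def)

lemma threshold_le: "y \<in> level n l \<Longrightarrow> threshold n l \<le> y"
  by (auto simp: threshold_def intro!: cInf_lower bdd_below_level)

lemma threshold_ge_lo: "lo \<le> threshold n l"
  using lo_less_hi by (auto simp: threshold_def level_def intro!: cInf_greatest)

lemma level_antimono: "l \<le> l' \<Longrightarrow> level n l' \<subseteq> level n l"
proof -
  assume "l \<le> l'"
  then have "real l / real n \<le> real l' / real n" by (simp add: divide_right_mono)
  then show ?thesis unfolding level_def by force
qed

lemma threshold_le_hi: "threshold n l \<le> hi \<Longrightarrow> level n l \<noteq> {}"
  by (auto simp: threshold_def)

lemma threshold_mono: "l \<le> l' \<Longrightarrow> threshold n l' \<le> hi \<Longrightarrow> threshold n l \<le> threshold n l'"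
proof -
  assume l: "l \<le> l'" and "threshold n l' \<le> hi"
  then have "level n l' \<noteq> {}" by (intro threshold_le_hi)
  moreover have "level n l' \<subseteq> level n l" using l by (rule level_antimono)
  ultimately show ?thesis
    using cInf_superset_mono[OF _ bdd_below_level] by (auto simp: threshold_def)
qed

lemma above_threshold:
  assumes "y \<in> {lo..hi}" "threshold n l < y"
  shows "real l / real n \<le> x y"
proof -
  have ne: "level n l \<noteq> {}" using assms threshold_le_hi[of n l] by auto
  then have "Inf (level n l) < y" using assms by (simp add: threshold_def)
  then obtain s where "s \<in> level n l" "s < y" using cInf_lessD[OF ne] by blast
  then show ?thesis using x_mono[of y s] assms by (auto simp: level_def)
qed

text \<open>Above the threshold the allocation is at least \<open>l / n\<close>, so \<open>W\<close>
  grows at least at that rate. The infimum need not be attained, so the bound is proved from points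
  \<open>r\<close> just above it and then pushed down.\<close>

lemma W_slope:
  assumes y: "y \<in> {lo..hi}" "threshold n l \<le> y"
  shows "real l / real n * (y - threshold n l) \<le> W y - W (threshold n l)"
proof (rule ccontr)
  define t where "t = threshold n l"
  define c where "c = real l / real n"
  have c0: "0 \<le> c" by (simp add: c_def)
  have t: "t \<in> {lo..hi}" using threshold_ge_lo[of n l] y by (auto simp: t_def)
  have bound: "c * (y - r) \<le> W y - W t" if r: "t < r" "r \<le> y" for r
  proof -
    have r': "r \<in> {lo..hi}" using r t y by auto
    have "c \<le> x r" using above_threshold[OF r'] r by (simp add: t_def c_def)
    then have "c * (y - r) \<le> x r * (y - r)" using r by (intro mult_right_mono) auto
    also have "\<dots> \<le> W y - W r" using W_subgradient[OF y(1) r'] by (simp add: algebra_simps)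
    finally have "c * (y - r) \<le> W y - W r" .
    moreover have "0 \<le> (r - t) * x t" using r x_range[OF t] by simp
    then have "W t \<le> W r" using W_subgradient[OF r' t] by simp
    ultimately show ?thesis by simp
  qed
  assume "\<not> real l / real n * (y - threshold n l) \<le> W y - W (threshold n l)"
  then have lt: "W y - W t < c * (y - t)" by (simp add: t_def c_def)
  then have ty: "t < y" using y by (cases "t = y") (auto simp: t_def)
  have "0 < c * (y - t)" using lt bound[of y] ty by auto
  then have c: "0 < c" using ty by (simp add: zero_less_mult_iff)
  \<comment> \<open>Starting at \<open>t + e\<close> instead of \<open>t\<close> loses
    \<open>c * e\<close>, at most half of the assumed gap, so \<open>bound\<close> at
    \<open>t + e\<close> is contradicted.\<close>
  define e where "e = min (y - t) ((c * (y - t) - (W y - W t)) / (2 * c))"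
  have e: "0 < e" "e \<le> y - t" using lt ty c by (auto simp: e_def)
  have "e \<le> (c * (y - t) - (W y - W t)) / (2 * c)" by (simp add: e_def)
  then have "c * e * 2 \<le> c * (y - t) - (W y - W t)" using c by (simp add: field_simps)
  moreover have "0 < c * e" using c e by simp
  moreover have "c * (y - (t + e)) \<le> W y - W t" using bound[of "t + e"] e by auto
  ultimately show False by (simp add: algebra_simps)
qed

text \<open>The sum is the integral from \<open>lo\<close> to \<open>y\<close> of the step function
  with a jump of \<open>1 / n\<close> at each of the first \<open>j\<close> thresholds, which lies
  below \<open>x\<close> away from the thresholds. The induction step splits at the new threshold
  \<open>t\<close>: beyond it the slope is \<open>Suc j / n\<close>, and the newest summand vanishes
  at \<open>t\<close> itself.\<close>

lemma W_lower:
  assumes "y \<in> {lo..hi}" "threshold n j \<le> y"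
  shows "(\<Sum>l\<in>{1..j}. (y - threshold n l) / real n) \<le> W y - W lo"
  using assms
proof (induction j arbitrary: y)
  case 0
  then show ?case using W_bounds by simp
next
  case (Suc j)
  define t where "t = threshold n (Suc j)"
  have t: "t \<in> {lo..hi}" using threshold_ge_lo[of n "Suc j"] Suc.prems by (auto simp: t_def)
  then have "threshold n j \<le> t" unfolding t_def by (intro threshold_mono) auto
  then have IH: "(\<Sum>l\<in>{1..j}. (t - threshold n l) / real n) \<le> W t - W lo" using Suc.IH t by blast
  have "(\<Sum>l\<in>{1..Suc j}. (y - threshold n l) / real n)
      = (\<Sum>l\<in>{1..Suc j}. (y - t) / real n + (t - threshold n l) / real n)"
    by (intro sum.cong) (auto simp: add_divide_distrib[symmetric])
  also have "\<dots> = (\<Sum>l\<in>{1..Suc j}. (y - t) / real n) + (\<Sum>l\<in>{1..Suc j}. (t - threshold n l) / real n)"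
    by (rule sum.distrib)
  also have "\<dots> = real (Suc j) / real n * (y - t) + (\<Sum>l\<in>{1..j}. (t - threshold n l) / real n)"
    by (simp add: t_def)
  also have "\<dots> \<le> W y - W lo"
    using IH W_slope[OF Suc.prems] by (simp add: t_def)
  finally show ?case .
qed

text \<open>Rounding \<open>x y\<close> down to \<open>j / n\<close> costs at most
  \<open>hi / n\<close>. Every remaining layer of height \<open>1 / n\<close> contributes
  \<open>y / n\<close> minus its rent \<open>(y - threshold) / n\<close>, that is, its threshold as
  a posted price.\<close>

lemma payment_le:
  assumes y: "y \<in> {lo..hi}" and n: "0 < n"
  shows "y * x y - (W y - W lo)
    \<le> hi / real n + (\<Sum>l\<in>{1..n}. threshold n l * indicator {threshold n l..} y) / real n"
proof -
  define j where "j = nat \<lfloor>real n * x y\<rfloor>"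
  have xy: "0 \<le> x y" "x y \<le> 1" using x_range[OF y] by auto
  have j: "real j \<le> real n * x y" "real n * x y < real j + 1"
    using xy by (auto simp: j_def)
  have "real n * x y \<le> real n" using xy by (simp add: mult_left_le)
  then have jn: "j \<le> n" using j by linarith
  have yj: "y \<in> level n j" using j n y by (auto simp: level_def field_simps)
  then have tj: "threshold n j \<le> y" by (rule threshold_le)
  have tl: "threshold n l \<le> y" if "l \<le> j" for l
    using threshold_le[of y n l] level_antimono[OF that, of n] yj by auto
  have "y * x y - (W y - W lo) \<le> y * x y - (\<Sum>l\<in>{1..j}. (y - threshold n l) / real n)"
    using W_lower[OF y tj] by simp
  also have "\<dots> = y * (x y - real j / real n) + (\<Sum>l\<in>{1..j}. threshold n l) / real n"
    by (simp add: diff_divide_distrib sum_subtractf sum_divide_distrib algebra_simps)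
  also have "y * (x y - real j / real n) \<le> hi * (1 / real n)"
  proof (intro mult_mono)
    have "real n * (x y - real j / real n) \<le> 1" using j n by (simp add: right_diff_distrib)
    then show "x y - real j / real n \<le> 1 / real n" using n by (simp add: pos_le_divide_eq mult.commute)
    show "0 \<le> x y - real j / real n" using yj by (simp add: level_def)
  qed (use y lo_nonneg in auto)
  also have "(\<Sum>l\<in>{1..j}. threshold n l) = (\<Sum>l\<in>{1..j}. threshold n l * indicator {threshold n l..} y)"
    using tl by (intro sum.cong) auto
  also have "\<dots> \<le> (\<Sum>l\<in>{1..n}. threshold n l * indicator {threshold n l..} y)"
    using jn threshold_ge_lo lo_nonneg
    by (intro sum_mono2) (auto simp: indicator_def intro: order_trans)
  finally show ?thesis using n by (simp add: divide_right_mono)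
qed

text \<open>In expectation the right-hand side of \<open>payment_le\<close> averages
  \<open>n\<close> posted-price revenues, each at most \<open>R\<close>, and the error
  \<open>hi / n\<close> vanishes.\<close>

lemma Myerson_bound:
  assumes R: "\<And>r. r * prob {r..} \<le> R"
  shows "(\<integral>y. y * x y - (W y - W lo) \<partial>D) \<le> R"
proof -
  have le: "(\<integral>y. y * x y - (W y - W lo) \<partial>D) \<le> hi / real n + R" if n: "0 < n" for n
  proof -
    let ?S = "\<lambda>y. \<Sum>l\<in>{1..n}. threshold n l * indicator {threshold n l..} y"
    have intS: "integrable D ?S"
      by (intro Bochner_Integration.integrable_sum integrable_mult_right integrable_real_indicator)
        (auto simp: emeasure_eq_measure)
    have "(\<integral>y. y * x y - (W y - W lo) \<partial>D) \<le> (\<integral>y. hi / real n + ?S y / real n \<partial>D)"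
      using intS
      by (intro integral_mono_AE eventually_mono[OF AE_in] payment_le[OF _ n]) auto
    also have "\<dots> = hi / real n + (\<integral>y. ?S y \<partial>D) / real n"
      using intS by (subst Bochner_Integration.integral_add) auto
    also have "(\<integral>y. ?S y \<partial>D) = (\<Sum>l\<in>{1..n}. threshold n l * prob {threshold n l..})"
      by (subst Bochner_Integration.integral_sum)
        (auto intro!: integrable_mult_right integrable_real_indicator simp: emeasure_eq_measure)
    also have "\<dots> \<le> (\<Sum>l\<in>{1..n}. R)" by (intro sum_mono R)
    also have "\<dots> = real n * R" by simp
    finally show ?thesis using n by (simp add: divide_right_mono)
  qed
  have "(\<lambda>n. hi / real (Suc n) + R) \<longlonglongrightarrow> 0 + R"
    using LIMSEQ_Suc[OF lim_const_over_n[of hi]] by (intro tendsto_intros) simp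
  moreover have "\<exists>N. \<forall>n\<ge>N. (\<integral>y. y * x y - (W y - W lo) \<partial>D) \<le> hi / real (Suc n) + R"
    using le[OF zero_less_Suc] by blast
  ultimately have "(\<integral>y. y * x y - (W y - W lo) \<partial>D) \<le> 0 + R"
    by (rule LIMSEQ_le_const)
  then show ?thesis by simp
qed

section \<open>Comparison with an affine utility of the same mean\<close>

definition "slope = (expectation W - W lo) / (\<mu> - lo)"

lemma slope_eq: "slope * (\<mu> - lo) = expectation W - W lo"
  using mean_bounds by (simp add: slope_def)

text \<open>\<open>W\<close> never falls below \<open>W lo\<close>, so the slope is nonnegative; it
  grows at most at rate 1, so the slope is at most 1; and
  \<open>expectation W - slope * (\<mu> - lo)\<close> is \<open>W lo\<close>, which is
  nonnegative.\<close>

lemma feasible_slope: "stage_feasible (expectation W) slope"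
proof -
  have "(\<integral>v. W lo + 0 * (v - lo) \<partial>D) \<le> (\<integral>v. W v \<partial>D)"
    using W_bounds by (intro integral_mono_AE integrable_shift integrable_W eventually_mono[OF AE_in]) auto
  then have 1: "W lo \<le> expectation W" by simp
  have "(\<integral>v. W v \<partial>D) \<le> (\<integral>v. W lo + 1 * (v - lo) \<partial>D)"
    using W_bounds by (intro integral_mono_AE integrable_shift integrable_W eventually_mono[OF AE_in]) auto
  then have 2: "expectation W \<le> W lo + (\<mu> - lo)" unfolding integral_shift by simp
  have lo: "0 \<le> W lo" using W_nonneg[of lo] lo_less_hi by simp
  show ?thesis
    using 1 2 lo mean_bounds unfolding stage_feasible_def slope_eq by (auto simp: slope_def)
qed

text \<open>\<open>W\<close> is convex and the affine function with the same mean agrees with it at \<open>lo\<close>, so they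
  cross once; a supergradient of the concave \<open>g\<close> at the crossing then compares the expectations.\<close>

lemma expectation_stage_fun_le:
  assumes g: "stage_fun K g"
  shows "expectation (\<lambda>v. g (W v)) \<le> expectation (\<lambda>v. g (expectation W + slope * (v - \<mu>)))"
proof -
  define L where "L v = expectation W + slope * (v - \<mu>)" for v
  note stage_fun_measurable[OF g, measurable]
  have slope0: "0 \<le> slope" using feasible_slope by (simp add: stage_feasible_def)
  have L_lo: "L lo = W lo" using slope_eq by (simp add: L_def algebra_simps)
  have L_nonneg: "0 \<le> L v" if "v \<in> {lo..hi}" for v
    using stage_feasible_balance[OF feasible_slope that] by (simp add: L_def)
  have L_mono: "L v \<le> L v'" if "v \<le> v'" for v v'
    using that slope0 by (auto simp: L_def intro!: mult_left_mono)
  define S where "S = {y \<in> {lo..hi}. W y \<le> L y}"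
  define z where "z = Sup S"
  have S: "lo \<in> S" "bdd_above S" using L_lo lo_less_hi by (auto simp: S_def intro!: bdd_aboveI[of _ hi])
  have z: "z \<in> {lo..hi}" using S unfolding z_def
    by (auto intro!: cSup_upper cSup_least simp: S_def)
  have below: "y \<le> z" if "y \<in> {lo..hi}" "W y \<le> L y" for y
    unfolding z_def using that S by (intro cSup_upper) (auto simp: S_def)
  have above: "z \<le> y" if y: "y \<in> {lo..hi}" "L y < W y" for y
  proof (rule ccontr)
    assume "\<not> z \<le> y"
    then obtain y' where y': "y' \<in> S" "y < y'"
      using less_cSupD[of S y] S by (auto simp: z_def not_le)
    have lo: "lo \<in> {lo..hi}" "y' \<in> {lo..hi}" "W y' \<le> L y'" using y' lo_less_hi by (auto simp: S_def)
    \<comment> \<open>Convexity of \<open>W\<close> between \<open>lo\<close> and \<open>y'\<close>: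
      the weights are chosen so that the subgradient terms at \<open>y\<close> cancel. Since
      \<open>W\<close> is at most \<open>L\<close> at both ends, it is at most \<open>L\<close> at
      \<open>y\<close>.\<close>
    have "(y' - y) * (W y + (lo - y) * x y) \<le> (y' - y) * W lo"
      using y' W_subgradient[OF lo(1) y(1)] by (intro mult_left_mono) auto
    moreover have "(y - lo) * (W y + (y' - y) * x y) \<le> (y - lo) * L y'"
      using y W_subgradient[OF lo(2) y(1)] lo(3) by (intro mult_left_mono) auto
    ultimately have "(y' - lo) * W y \<le> (y' - y) * L lo + (y - lo) * L y'"
      using L_lo by (simp add: algebra_simps)
    also have "\<dots> = (y' - lo) * L y" by (simp add: L_def algebra_simps)
    finally have "W y \<le> L y" using y y' by (auto simp: mult_le_cancel_left)
    then show False using y by simp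
  qed
  obtain s where s: "\<And>y. 0 \<le> y \<Longrightarrow> g y \<le> g (L z) + s * (y - L z)"
    using stage_fun_supergradient[OF g L_nonneg[OF z]] by blast
  \<comment> \<open>Where \<open>W \<le> L\<close>, both values are at most \<open>L z\<close>;
    where \<open>W > L\<close>, both are at least \<open>L z\<close>. In either case the
    supergradient at \<open>L z\<close> gives the same linear bound, whose integral is zero because
    the means agree.\<close>
  have main: "g (W y) - g (L y) \<le> s * (W y - L y)" if y: "y \<in> {lo..hi}" for y
  proof (cases "W y \<le> L y")
    case True
    then have "s * (L y - W y) \<le> g (L y) - g (W y)"
      using below[OF y True] W_nonneg[OF y]
      by (intro stage_fun_supergradient_below[OF g s]) (auto intro: L_mono)
    then show ?thesis by (simp add: algebra_simps)
  next
    case False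
    then show ?thesis
      using above[OF y] L_nonneg[OF z]
      by (intro stage_fun_supergradient_above[OF g s]) (auto intro: L_mono)
  qed
  have iL: "integrable D (\<lambda>v. L v)" unfolding L_def by (rule integrable_shift)
  have igL: "integrable D (\<lambda>v. g (L v))" unfolding L_def by (rule integrable_stage[OF g])
  have K: "0 \<le> K" "g 0 = 0" using g by (auto simp: stage_fun_def)
  have igW: "integrable D (\<lambda>v. g (W v))"
  proof (rule integrable_bounded)
    fix v assume v: "v \<in> {lo..hi}"
    have "\<bar>g (W v)\<bar> \<le> K * \<bar>W v\<bar>" using stage_fun_Lipschitz[OF g, of "W v" 0] K by simp
    also have "\<dots> \<le> K * (W lo + (hi - lo))"
      using W_bounds[OF v] W_nonneg[OF v] K v by (intro mult_left_mono) auto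
    finally show "\<bar>g (W v)\<bar> \<le> K * (W lo + (hi - lo))" .
  qed measurable
  have "(\<integral>v. g (W v) - g (L v) \<partial>D) \<le> (\<integral>v. s * (W v - L v) \<partial>D)"
    using igW igL iL main
    by (intro integral_mono_AE eventually_mono[OF AE_in]) auto
  also have "\<dots> = s * (expectation W - expectation L)" using iL by simp
  also have "expectation L = expectation W" unfolding L_def integral_shift by simp
  finally show ?thesis using igW igL by (simp add: L_def)
qed

text \<open>The mean rent \<open>slope * (\<mu> - lo)\<close> is at most
  \<open>slope * \<mu>\<close> because \<open>lo\<close> is nonnegative, and that is the linear term
  of \<open>stage_value\<close> at the feasible choice \<open>slope\<close>.\<close>

theorem day_bound:
  assumes g: "stage_fun K g" and R: "\<And>r. r * prob {r..} \<le> R"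
    and G: "\<And>Y. stage_feasible (expectation W) Y \<Longrightarrow> stage_value g (expectation W) Y \<le> G"
  shows "expectation (\<lambda>v. v * x v) + expectation (\<lambda>v. g (W v)) \<le> R + G"
proof -
  have "(\<integral>y. y * x y - (W y - W lo) \<partial>D) = expectation (\<lambda>v. v * x v) - (expectation W - W lo)"
    by (simp add: Bochner_Integration.integral_diff)
  then have "expectation (\<lambda>v. v * x v) \<le> R + slope * (\<mu> - lo)"
    using Myerson_bound[OF R] slope_eq by simp
  also have "\<dots> \<le> R + slope * \<mu>"
    using feasible_slope lo_nonneg by (auto simp: stage_feasible_def intro!: mult_left_mono)
  finally show ?thesis
    using expectation_stage_fun_le[OF g] G[OF feasible_slope] by (simp add: stage_value_def)
qed

end

subsection \<open>Optimal stage decisions\<close>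

text \<open>For negative \<open>c\<close> no \<open>Y\<close> is feasible, so \<open>opt\<close> is
  unconstrained there.\<close>

locale optimal_stage = value_dist +
  fixes K :: real and g opt :: "real \<Rightarrow> real"
  assumes g: "stage_fun K g"
    and opt_feasible: "\<And>c. 0 \<le> c \<Longrightarrow> stage_feasible c (opt c)"
    and opt_best: "\<And>c Y. stage_feasible c Y \<Longrightarrow> stage_value g c Y \<le> stage_value g c (opt c)"
begin

definition stage_max :: "real \<Rightarrow> real" where
  "stage_max c = (if c < 0 then 0 else stage_value g c (opt c))"

lemma K_nonneg: "0 \<le> K" and g_0: "g 0 = 0"
  using g by (auto simp: stage_fun_def)

section \<open>The stage maximum is again a stage function\<close>

lemma stage_value_nonneg: "stage_feasible c Y \<Longrightarrow> 0 \<le> stage_value g c Y"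
  using stage_fun_nonneg[OF g] mean_pos
  by (auto simp: stage_value_def stage_feasible_def intro!: add_nonneg_nonneg Bochner_Integration.integral_nonneg)

text \<open>The bound \<open>g c \<le> K * c\<close> integrates to \<open>K * c\<close> because the
  balance has mean \<open>c\<close>. Feasibility gives \<open>Y \<le> c / (\<mu> - lo)\<close>,
  which bounds the linear term \<open>Y * \<mu>\<close>.\<close>

lemma stage_value_le:
  assumes Y: "stage_feasible c Y"
  shows "stage_value g c Y \<le> (K + \<mu> / (\<mu> - lo)) * c"
proof -
  have "(\<integral>v. g (c + Y * (v - \<mu>)) \<partial>D) \<le> (\<integral>v. K * c + (K * Y) * (v - \<mu>) \<partial>D)"
  proof (rule integral_mono_AE[OF integrable_stage[OF g] integrable_shift], rule eventually_mono[OF AE_in])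
    fix v assume "v \<in> {lo..hi}"
    then have "0 \<le> c + Y * (v - \<mu>)" by (rule stage_feasible_balance[OF Y])
    then have "g (c + Y * (v - \<mu>)) \<le> K * (c + Y * (v - \<mu>))" using g by (simp add: stage_fun_def)
    then show "g (c + Y * (v - \<mu>)) \<le> K * c + (K * Y) * (v - \<mu>)" by (simp add: algebra_simps)
  qed
  also have "\<dots> = K * c" unfolding integral_shift by simp
  finally have 1: "(\<integral>v. g (c + Y * (v - \<mu>)) \<partial>D) \<le> K * c" .
  have "Y \<le> c / (\<mu> - lo)" using Y mean_bounds by (simp add: stage_feasible_def pos_le_divide_eq)
  then have "Y * \<mu> \<le> c / (\<mu> - lo) * \<mu>" using mean_pos by (intro mult_right_mono) auto
  then show ?thesis using 1 by (simp add: stage_value_def algebra_simps)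
qed

lemma stage_feasible_convex:
  assumes "stage_feasible c Y" "stage_feasible c' Y'" "0 \<le> t" "t \<le> 1"
  shows "stage_feasible ((1 - t) * c + t * c') ((1 - t) * Y + t * Y')"
proof -
  have "(1 - t) * (Y * (\<mu> - lo)) + t * (Y' * (\<mu> - lo)) \<le> (1 - t) * c + t * c'"
    using assms by (intro add_mono mult_left_mono) (auto simp: stage_feasible_def)
  moreover have "(1 - t) * Y + t * Y' \<le> (1 - t) * 1 + t * 1"
    using assms by (intro add_mono mult_left_mono) (auto simp: stage_feasible_def)
  moreover have "0 \<le> (1 - t) * Y + t * Y'"
    using assms by (auto simp: stage_feasible_def)
  moreover have "((1 - t) * Y + t * Y') * (\<mu> - lo) = (1 - t) * (Y * (\<mu> - lo)) + t * (Y' * (\<mu> - lo))"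
    by (simp add: algebra_simps)
  ultimately show ?thesis unfolding stage_feasible_def by simp
qed

lemma stage_value_concave:
  assumes Y: "stage_feasible c Y" "stage_feasible c' Y'" and t: "0 \<le> t" "t \<le> 1"
  shows "(1 - t) * stage_value g c Y + t * stage_value g c' Y'
    \<le> stage_value g ((1 - t) * c + t * c') ((1 - t) * Y + t * Y')"
proof -
  let ?C = "(1 - t) * c + t * c'" and ?Y = "(1 - t) * Y + t * Y'"
  have i: "integrable D (\<lambda>v. (1 - t) * g (c + Y * (v - \<mu>)))" "integrable D (\<lambda>v. t * g (c' + Y' * (v - \<mu>)))"
    using integrable_stage[OF g] by auto
  have "(1 - t) * (\<integral>v. g (c + Y * (v - \<mu>)) \<partial>D) + t * (\<integral>v. g (c' + Y' * (v - \<mu>)) \<partial>D)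
      = (\<integral>v. (1 - t) * g (c + Y * (v - \<mu>)) + t * g (c' + Y' * (v - \<mu>)) \<partial>D)"
    using i by simp
  also have "\<dots> \<le> (\<integral>v. g (?C + ?Y * (v - \<mu>)) \<partial>D)"
  proof (rule integral_mono_AE[OF _ integrable_stage[OF g]], goal_cases)
    case 1 show ?case using i by (rule Bochner_Integration.integrable_add)
  next
    case 2
    show ?case using AE_in
    proof eventually_elim
      case (elim v)
      have "(1 - t) * g (c + Y * (v - \<mu>)) + t * g (c' + Y' * (v - \<mu>))
        \<le> g ((1 - t) * (c + Y * (v - \<mu>)) + t * (c' + Y' * (v - \<mu>)))"
        using t by (intro stage_fun_concaveD[OF g] stage_feasible_balance Y elim)
      also have "(1 - t) * (c + Y * (v - \<mu>)) + t * (c' + Y' * (v - \<mu>)) = ?C + ?Y * (v - \<mu>)"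
        by (simp add: algebra_simps)
      finally show ?case .
    qed
  qed
  finally show ?thesis by (simp add: stage_value_def algebra_simps)
qed

lemma stage_value_mono: "c \<le> c' \<Longrightarrow> stage_value g c Y \<le> stage_value g c' Y"
  using g integrable_stage[OF g]
  by (auto simp: stage_value_def stage_fun_def intro!: integral_mono elim!: monoD)

lemma stage_value_Lipschitz:
  "\<bar>stage_value g c Y - stage_value g c' Y'\<bar> \<le> K * \<bar>c - c'\<bar> + (K * (hi - lo) + \<mu>) * \<bar>Y - Y'\<bar>"
proof -
  have i: "integrable D (\<lambda>v. g (c + Y * (v - \<mu>)) - g (c' + Y' * (v - \<mu>)))"
    using integrable_stage[OF g] by auto
  have "\<bar>\<integral>v. g (c + Y * (v - \<mu>)) - g (c' + Y' * (v - \<mu>)) \<partial>D\<bar>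
      \<le> (\<integral>v. \<bar>g (c + Y * (v - \<mu>)) - g (c' + Y' * (v - \<mu>))\<bar> \<partial>D)"
    by (rule integral_abs_bound)
  also have "\<dots> \<le> (\<integral>v. K * (\<bar>c - c'\<bar> + \<bar>Y - Y'\<bar> * (hi - lo)) \<partial>D)"
  proof (rule integral_mono_AE, goal_cases)
    case 3
    show ?case using AE_in
    proof eventually_elim
      case (elim v)
      have "\<bar>g (c + Y * (v - \<mu>)) - g (c' + Y' * (v - \<mu>))\<bar>
          \<le> K * \<bar>(c + Y * (v - \<mu>)) - (c' + Y' * (v - \<mu>))\<bar>"
        by (rule stage_fun_Lipschitz[OF g])
      also have "(c + Y * (v - \<mu>)) - (c' + Y' * (v - \<mu>)) = (c - c') + (Y - Y') * (v - \<mu>)"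
        by (simp add: algebra_simps)
      also have "\<bar>\<dots>\<bar> \<le> \<bar>c - c'\<bar> + \<bar>Y - Y'\<bar> * (hi - lo)"
      proof -
        have "\<bar>(Y - Y') * (v - \<mu>)\<bar> \<le> \<bar>Y - Y'\<bar> * (hi - lo)"
          unfolding abs_mult using elim mean_bounds by (intro mult_left_mono) auto
        then show ?thesis by linarith
      qed
      finally show ?case using K_nonneg by (simp add: mult_left_mono)
    qed
  qed (use i in auto)
  finally have "\<bar>(\<integral>v. g (c + Y * (v - \<mu>)) \<partial>D) - (\<integral>v. g (c' + Y' * (v - \<mu>)) \<partial>D)\<bar>
      \<le> K * (\<bar>c - c'\<bar> + \<bar>Y - Y'\<bar> * (hi - lo))"
    using integrable_stage[OF g] by simp
  moreover have "\<bar>Y * \<mu> - Y' * \<mu>\<bar> = \<mu> * \<bar>Y - Y'\<bar>"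
    using mean_pos by (simp add: abs_mult flip: left_diff_distrib)
  ultimately show ?thesis unfolding stage_value_def by (simp add: algebra_simps) linarith
qed

lemma stage_feasible_mono: "stage_feasible c Y \<Longrightarrow> c \<le> c' \<Longrightarrow> stage_feasible c' Y"
  by (simp add: stage_feasible_def)

text \<open>Feasible pairs \<open>(c, Y)\<close> form a convex set on which the stage value is
  jointly concave, and maximizing out one variable preserves concavity. Nonnegativity and the linear
  bound squeeze the value at 0 to 0.\<close>

lemma stage_fun_stage_max: "stage_fun (K + \<mu> / (\<mu> - lo)) stage_max"
  unfolding stage_fun_def
proof (intro conjI allI impI)
  show K': "0 \<le> K + \<mu> / (\<mu> - lo)" using K_nonneg mean_pos mean_bounds by simp
  have le: "stage_max c \<le> (K + \<mu> / (\<mu> - lo)) * c" if "0 \<le> c" for c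
    using stage_value_le[OF opt_feasible[OF that]] that by (simp add: stage_max_def)
  then show "\<And>c. 0 \<le> c \<Longrightarrow> stage_max c \<le> (K + \<mu> / (\<mu> - lo)) * c" .
  have nonneg: "0 \<le> stage_max c" for c
    using stage_value_nonneg[OF opt_feasible] by (simp add: stage_max_def)
  show "stage_max c = 0" if "c \<le> 0" for c
    using that le[of c] nonneg[of c] by (cases "c = 0") (auto simp: stage_max_def)
  show "mono stage_max"
  proof (rule monoI)
    fix c c' :: real assume cc: "c \<le> c'"
    show "stage_max c \<le> stage_max c'"
    proof (cases "c < 0")
      case True
      then show ?thesis using nonneg[of c'] by (simp add: stage_max_def)
    next
      case False
      then have "stage_feasible c' (opt c)" using stage_feasible_mono[OF opt_feasible cc] by simp
      then show ?thesis using False cc stage_value_mono[OF cc, of "opt c"] opt_best[of c' "opt c"]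
        by (simp add: stage_max_def)
    qed
  qed
  show "concave_on {0..} stage_max"
    unfolding concave_on_iff
  proof (intro conjI ballI allI impI)
    fix c c' u t :: real assume c: "c \<in> {0..}" "c' \<in> {0..}" and t: "0 \<le> u" "0 \<le> t" "u + t = 1"
    have u: "u = 1 - t" using t by simp
    have *: "stage_feasible ((1 - t) * c + t * c') ((1 - t) * opt c + t * opt c')"
      using c t by (intro stage_feasible_convex opt_feasible) auto
    have "(1 - t) * stage_value g c (opt c) + t * stage_value g c' (opt c')
      \<le> stage_value g ((1 - t) * c + t * c') ((1 - t) * opt c + t * opt c')"
      using c t by (intro stage_value_concave opt_feasible) auto
    also have "\<dots> \<le> stage_value g ((1 - t) * c + t * c') (opt ((1 - t) * c + t * c'))"
      by (rule opt_best[OF *])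
    finally show "u * stage_max c + t * stage_max c' \<le> stage_max (u *\<^sub>R c + t *\<^sub>R c')"
      using c stage_feasible_ge_0[OF *] by (simp add: stage_max_def u)
  qed simp
qed

text \<open>Two optimizers force the objective to be affine between them, hence \<open>g\<close> to be affine on both
  sides of \<open>c\<close>; the two slopes differ because the expectation has to offset \<open>Y * \<mu>\<close>.\<close>

lemma kink_of_two_optimizers:
  assumes Y1: "stage_feasible c Y1" "stage_value g c Y1 = stage_max c"
    and Y2: "stage_feasible c Y2" "stage_value g c Y2 = stage_max c"
    and less: "Y1 < Y2"
  shows "\<exists>r\<in>\<rat>. \<forall>y\<ge>0. y \<noteq> c \<longrightarrow> g y - r * y < g c - r * c"
proof -
  have c0: "0 \<le> c" using Y1 by (auto intro: stage_feasible_ge_0)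
  have Y1_0: "0 \<le> Y1" and Y2_pos: "0 < Y2" using Y1 less by (auto simp: stage_feasible_def)
  \<comment> \<open>By concavity the midpoint of two optimizers is an optimizer too.\<close>
  define m where "m = (Y1 + Y2) / 2"
  have m: "m = (1 - 1/2) * Y1 + 1/2 * Y2" by (simp add: m_def field_simps)
  have fm: "stage_feasible c m"
    using stage_feasible_convex[OF Y1(1) Y2(1), of "1/2"] by (simp add: m)
  have "stage_value g c m \<le> stage_max c"
    using opt_best[OF fm] c0 by (simp add: stage_max_def)
  moreover have "stage_max c \<le> stage_value g c m"
    using stage_value_concave[OF Y1(1) Y2(1), of "1/2"] Y1(2) Y2(2) by (simp add: m)
  ultimately have vm: "stage_value g c m = stage_max c" by simp
  \<comment> \<open>The concavity defect at the midpoint. It is nonnegative, and its integral is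
    zero because the three stage values agree and the linear terms cancel; full support then makes
    it vanish for every value.\<close>
  define h where "h v = 2 * g (c + m * (v - \<mu>)) - g (c + Y1 * (v - \<mu>)) - g (c + Y2 * (v - \<mu>))" for v
  have ints: "integrable D (\<lambda>v. 2 * g (c + m * (v - \<mu>)))" "integrable D (\<lambda>v. g (c + Y1 * (v - \<mu>)))"
    "integrable D (\<lambda>v. g (c + Y2 * (v - \<mu>)))" using integrable_stage[OF g] by auto
  have h0: "h v = 0" if v: "v \<in> {lo..hi}" for v
  proof (rule continuous_nonneg_eq_0[OF _ _ _ _ v])
    show "continuous_on {lo..hi} h"
      unfolding h_def
      by (intro continuous_intros continuous_on_compose2[OF stage_fun_continuous[OF g, of UNIV]]) auto
    show "integrable D h" unfolding h_def using ints by (intro Bochner_Integration.integrable_diff)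
    have "expectation h = 2 * (\<integral>v. g (c + m * (v - \<mu>)) \<partial>D) - (\<integral>v. g (c + Y1 * (v - \<mu>)) \<partial>D)
      - (\<integral>v. g (c + Y2 * (v - \<mu>)) \<partial>D)" unfolding h_def using ints by simp
    then show "expectation h = 0"
      using vm Y1(2) Y2(2) by (simp add: stage_value_def m_def field_simps)
    fix v assume v: "v \<in> {lo..hi}"
    have "(1 - 1/2) * g (c + Y1 * (v - \<mu>)) + 1/2 * g (c + Y2 * (v - \<mu>))
        \<le> g ((1 - 1/2) * (c + Y1 * (v - \<mu>)) + 1/2 * (c + Y2 * (v - \<mu>)))"
      by (intro stage_fun_concaveD[OF g] stage_feasible_balance[OF _ v] Y1 Y2) auto
    also have "(1 - 1/2) * (c + Y1 * (v - \<mu>)) + 1/2 * (c + Y2 * (v - \<mu>)) = c + m * (v - \<mu>)"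
      by (simp add: m_def field_simps)
    finally show "0 \<le> h v" by (simp add: h_def)
  qed
  \<comment> \<open>Along the ray in direction \<open>e\<close>, a zero defect at
    \<open>v = \<mu> + e * s\<close> makes \<open>g\<close> affine on displacements from
    \<open>Y1 * s\<close> to \<open>Y2 * s\<close>. Varying \<open>s\<close> gives scaled intervals
    of ratio \<open>Y1 / Y2 < 1\<close>.\<close>
  have side: "\<exists>b. \<forall>s\<in>{0..Y2 * T}. g (c + e * s) = g c + b * s"
    if e: "e \<in> {1, -1}" and T: "0 < T" and inv: "\<And>t. 0 < t \<Longrightarrow> t \<le> T \<Longrightarrow> \<mu> + e * t \<in> {lo..hi}" for e T
  proof -
    define G where "G s = g (c + e * s)" for s
    have "\<exists>b. \<forall>s\<in>{0..Y2 * T}. G s = G 0 + b * s"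
    proof (rule affine_of_affine_scales[where r = "Y1 / Y2"])
      show "continuous_on {0..Y2 * T} G" unfolding G_def
        by (intro continuous_intros continuous_on_compose2[OF stage_fun_continuous[OF g, of UNIV]]) auto
      fix t assume t: "0 < t" "t \<le> Y2 * T"
      define s where "s = t / Y2"
      have s: "0 < s" "s \<le> T" using t Y2_pos by (auto simp: s_def field_simps)
      have v: "\<mu> + e * s \<in> {lo..hi}" by (rule inv[OF s])
      have bal: "0 \<le> c + e * (Y * s)" if "stage_feasible c Y" for Y
        using stage_feasible_balance[OF that v] by (simp add: algebra_simps)
      have eq: "Y1 / Y2 * t = Y1 * s" "t = Y2 * s" using Y2_pos by (auto simp: s_def)
      have pos: "0 \<le> c + e * y" if "y \<in> {Y1 * s..Y2 * s}" for y
        using bal[OF Y1(1)] bal[OF Y2(1)] that e by auto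
      have conc: "concave_on {Y1 * s..Y2 * s} G"
        unfolding concave_on_iff
      proof (intro conjI ballI allI impI)
        fix x y u w :: real
        assume xy: "x \<in> {Y1 * s..Y2 * s}" "y \<in> {Y1 * s..Y2 * s}" and uw: "0 \<le> u" "0 \<le> w" "u + w = 1"
        have u: "u = 1 - w" using uw by simp
        have "(1 - w) * G x + w * G y \<le> g ((1 - w) * (c + e * x) + w * (c + e * y))"
          unfolding G_def using uw xy by (intro stage_fun_concaveD[OF g] pos) auto
        also have "(1 - w) * (c + e * x) + w * (c + e * y) = c + e * ((1 - w) * x + w * y)"
          by (simp add: algebra_simps)
        finally show "u * G x + w * G y \<le> G (u *\<^sub>R x + w *\<^sub>R y)" by (simp add: G_def u)
      qed simp
      have lt: "Y1 * s < Y2 * s" using less s by simp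
      have "2 * G ((Y1 * s + Y2 * s) / 2) \<le> G (Y1 * s) + G (Y2 * s)"
        using h0[OF v] by (simp add: h_def G_def m_def field_simps)
      note aff = concave_chord_affine[OF conc lt this]
      define b where "b = (G (Y2 * s) - G (Y1 * s)) / (Y2 * s - Y1 * s)"
      have "G x = (G (Y1 * s) - b * (Y1 * s)) + b * x" if "x \<in> {Y1 * s..Y2 * s}" for x
        using aff[OF that, folded b_def] unfolding right_diff_distrib by linarith
      then show "\<exists>a b. \<forall>x\<in>{Y1 / Y2 * t..t}. G x = a + b * x" unfolding eq(1) eq(2)[symmetric] by blast
    qed (use Y1_0 Y2_pos less T in auto)
    then show ?thesis by (simp add: G_def)
  qed
  obtain bp where bp: "\<And>s. s \<in> {0..Y2 * (hi - \<mu>)} \<Longrightarrow> g (c + s) = g c + bp * s"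
  proof -
    have "\<exists>b. \<forall>s\<in>{0..Y2 * (hi - \<mu>)}. g (c + 1 * s) = g c + b * s"
      using mean_bounds by (intro side) auto
    then obtain b where "\<forall>s\<in>{0..Y2 * (hi - \<mu>)}. g (c + 1 * s) = g c + b * s" ..
    then show ?thesis by (intro that[of b]) simp
  qed
  obtain bm where bm: "\<And>s. s \<in> {0..Y2 * (\<mu> - lo)} \<Longrightarrow> g (c - s) = g c + bm * s"
  proof -
    have "\<exists>b. \<forall>s\<in>{0..Y2 * (\<mu> - lo)}. g (c + - 1 * s) = g c + b * s"
      using mean_bounds by (intro side) auto
    then obtain b where "\<forall>s\<in>{0..Y2 * (\<mu> - lo)}. g (c + - 1 * s) = g c + b * s" ..
    then show ?thesis by (intro that[of b]) simp
  qed
  \<comment> \<open>\<open>g\<close> now has slope \<open>bp\<close> to the right of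
    \<open>c\<close> and \<open>- bm\<close> to the left. It is written as a line of slope
    \<open>- bm\<close> plus \<open>bp + bm\<close> times a positive part, and the line contributes
    only \<open>g c\<close> in expectation.\<close>
  define A where "A = (\<integral>v. max (v - \<mu>) 0 \<partial>D)"
  have intA: "integrable D (\<lambda>v. max (v - \<mu>) 0)" by (intro integrable_max Bochner_Integration.integrable_diff) auto
  have A0: "0 \<le> A" unfolding A_def by (intro Bochner_Integration.integral_nonneg) auto
  have value_eq: "stage_value g c Y = g c + Y * ((bp + bm) * A + \<mu>)" if Y: "0 \<le> Y" "Y \<le> Y2" for Y
  proof -
    have "(\<integral>v. g (c + Y * (v - \<mu>)) \<partial>D)
        = (\<integral>v. (g c + (- bm * Y) * (v - \<mu>)) + (bp + bm) * Y * max (v - \<mu>) 0 \<partial>D)"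
    proof (rule integral_cong_AE)
      show "(\<lambda>v. g (c + Y * (v - \<mu>))) \<in> borel_measurable D"
        using integrable_stage[OF g] by (rule borel_measurable_integrable)
      show "AE v in D. g (c + Y * (v - \<mu>)) = (g c + (- bm * Y) * (v - \<mu>)) + (bp + bm) * Y * max (v - \<mu>) 0"
        using AE_in
      proof eventually_elim
        case (elim v)
        show ?case
        proof (cases "\<mu> \<le> v")
          case True
          then have "Y * (v - \<mu>) \<in> {0..Y2 * (hi - \<mu>)}" using elim Y by (auto intro!: mult_mono)
          from bp[OF this] show ?thesis using True by (simp add: algebra_simps)
        next
          case False
          then have "Y * (\<mu> - v) \<in> {0..Y2 * (\<mu> - lo)}" using elim Y by (auto intro!: mult_mono)
          from bm[OF this] show ?thesis using False by (simp add: algebra_simps)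
        qed
      qed
    qed measurable
    also have "\<dots> = (\<integral>v. g c + (- bm * Y) * (v - \<mu>) \<partial>D) + (\<integral>v. (bp + bm) * Y * max (v - \<mu>) 0 \<partial>D)"
      using intA by (intro Bochner_Integration.integral_add integrable_shift) auto
    also have "\<dots> = g c + (bp + bm) * Y * A" unfolding integral_shift A_def by simp
    finally show ?thesis by (simp add: stage_value_def algebra_simps)
  qed
  \<comment> \<open>The stage value is affine in \<open>Y\<close> and takes equal values at two
    points, so its slope is zero. As \<open>\<mu> > 0\<close>, the two one-sided slopes must
    differ.\<close>
  have "Y1 * ((bp + bm) * A + \<mu>) = Y2 * ((bp + bm) * A + \<mu>)"
    using value_eq[of Y1] value_eq[of Y2] Y1(2) Y2(2) Y1_0 less by simp
  then have "(bp + bm) * A + \<mu> = 0" using less by simp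
  then have "(bp + bm) * A < 0" using mean_pos by simp
  then have "bp < - bm" using A0 by (auto simp: mult_less_0_iff)
  then obtain r where r: "r \<in> \<rat>" "bp < r" "r < - bm" using Rats_dense_in_real by blast
  have "g y - r * y < g c - r * c" if y: "0 \<le> y" "y \<noteq> c" for y
  proof -
    \<comment> \<open>Beyond the segment where \<open>g\<close> is affine, concavity keeps it below
      the extended line.\<close>
    have chord: "g (c + e * d) \<le> g c + b * d"
      if b: "g (c + e * T) = g c + b * T" and T: "0 < T" "T \<le> d" and nn: "0 \<le> c + e * d" for e d b T
    proof -
      define w where "w = T / d"
      have w: "0 < w" "w \<le> 1" and wd: "w * d = T" using T by (auto simp: w_def)
      have "(1 - w) * g c + w * g (c + e * d) \<le> g ((1 - w) * c + w * (c + e * d))"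
        using w c0 nn by (intro stage_fun_concaveD[OF g]) auto
      also have "(1 - w) * c + w * (c + e * d) = c + e * T" using wd by (simp add: algebra_simps)
      also have "g (c + e * T) = g c + w * (b * d)" using b wd by (metis mult.left_commute)
      finally have "w * g (c + e * d) \<le> w * (g c + b * d)" by (simp add: algebra_simps)
      then show ?thesis using w by simp
    qed
    show ?thesis
    proof (cases "c < y")
      case True
      define T where "T = min (Y2 * (hi - \<mu>)) (y - c)"
      have T: "0 < T" "T \<le> y - c" "T \<in> {0..Y2 * (hi - \<mu>)}"
        using True Y2_pos mean_bounds by (auto simp: T_def)
      have "g (c + 1 * (y - c)) \<le> g c + bp * (y - c)"
        by (rule chord[OF _ T(1,2)]) (use bp[OF T(3)] y in auto)
      moreover have "bp * (y - c) < r * (y - c)" using True r by simp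
      ultimately show ?thesis by (simp add: algebra_simps)
    next
      case False
      then have yc: "y < c" using y by simp
      define T where "T = min (Y2 * (\<mu> - lo)) (c - y)"
      have T: "0 < T" "T \<le> c - y" "T \<in> {0..Y2 * (\<mu> - lo)}"
        using yc Y2_pos mean_bounds by (auto simp: T_def)
      have "g (c + - 1 * (c - y)) \<le> g c + bm * (c - y)"
        by (rule chord[OF _ T(1,2)]) (use bm[OF T(3)] y in auto)
      moreover have "bm * (c - y) < - r * (c - y)" using yc r by (intro mult_strict_right_mono) auto
      ultimately show ?thesis by (simp add: algebra_simps)
    qed
  qed
  then show ?thesis using r(1) by blast
qed

text \<open>0 is included because the function tested in \<open>opt_measurable\<close> changes
  branch there.\<close>

definition exceptional :: "real set" where
  "exceptional = insert 0 {c. 0 \<le> c \<and> (\<exists>r\<in>\<rat>. \<forall>y\<ge>0. y \<noteq> c \<longrightarrow> g y - r * y < g c - r * c)}"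

lemma optimizer_unique:
  assumes that: "c \<notin> exceptional" "stage_feasible c Y" "stage_value g c Y = stage_max c"
  shows "Y = opt c"
proof (rule ccontr)
  assume "Y \<noteq> opt c"
  moreover have c: "0 \<le> c" using that(2) by (rule stage_feasible_ge_0)
  moreover have "stage_value g c (opt c) = stage_max c" using c by (simp add: stage_max_def)
  ultimately have "\<exists>r\<in>\<rat>. \<forall>y\<ge>0. y \<noteq> c \<longrightarrow> g y - r * y < g c - r * c"
    using kink_of_two_optimizers[OF that(2,3) opt_feasible[OF c]]
      kink_of_two_optimizers[OF opt_feasible[OF c] _ that(2,3)] by (metis linorder_neqE)
  then show False using that(1) c by (simp add: exceptional_def)
qed

text \<open>A compactness argument: a subsequence staying away from \<open>opt c\<close> has a limit
  point \<open>Z\<close>. The constraint is closed, and both the stage value and its maximum are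
  continuous, so \<open>Z\<close> is optimal at \<open>c\<close> and uniqueness applies.\<close>

lemma opt_tendsto:
  assumes X: "X \<longlonglongrightarrow> c" "\<And>n. 0 < X n" and c: "0 < c" "c \<notin> exceptional"
  shows "(\<lambda>n. opt (X n)) \<longlonglongrightarrow> opt c"
proof (rule ccontr)
  assume "\<not> (\<lambda>n. opt (X n)) \<longlonglongrightarrow> opt c"
  then obtain e where e: "0 < e" "\<not> eventually (\<lambda>n. dist (opt (X n)) (opt c) < e) sequentially"
    by (auto simp: tendsto_iff)
  obtain s :: "nat \<Rightarrow> nat" where s: "strict_mono s" "\<And>n. e \<le> dist (opt (X (s n))) (opt c)"
    using not_eventually_sequentiallyD[OF e(2)] unfolding not_less by metis
  have feas: "stage_feasible (X n) (opt (X n))" for n using X(2)[of n] by (intro opt_feasible) simp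
  have "opt (X (s n)) \<in> {0..1}" for n using feas[of "s n"] by (simp add: stage_feasible_def)
  moreover have "seq_compact {0..1::real}" by (simp flip: compact_eq_seq_compact_metric)
  ultimately obtain Z q where Z: "strict_mono q" "((\<lambda>n. opt (X (s n))) \<circ> q) \<longlonglongrightarrow> Z"
    using seq_compactE[of "{0..1}" "\<lambda>n. opt (X (s n))"] by blast
  define x where "x n = X (s (q n))" for n
  have oZ: "(\<lambda>n. opt (x n)) \<longlonglongrightarrow> Z" using Z(2) by (simp add: x_def o_def)
  have xc: "x \<longlonglongrightarrow> c"
    using LIMSEQ_subseq_LIMSEQ[OF X(1) strict_mono_o[OF s(1) Z(1)]] by (simp add: x_def[abs_def] o_def)
  have fx: "stage_feasible (x n) (opt (x n))" for n using feas by (simp add: x_def)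
  have "stage_feasible c Z"
    unfolding stage_feasible_def
  proof (intro conjI)
    have fx': "0 \<le> opt (x n)" "opt (x n) \<le> 1" "opt (x n) * (\<mu> - lo) \<le> x n" for n
      using fx[of n] by (auto simp: stage_feasible_def)
    show "0 \<le> Z" by (rule LIMSEQ_le_const[OF oZ]) (use fx' in blast)
    show "Z \<le> 1" by (rule LIMSEQ_le_const2[OF oZ]) (use fx' in blast)
    show "Z * (\<mu> - lo) \<le> c"
      by (rule LIMSEQ_le[OF tendsto_mult_right[OF oZ] xc]) (use fx' in blast)
  qed
  moreover have "stage_value g c Z = stage_max c"
  proof -
    have "(\<lambda>n. K * \<bar>x n - c\<bar> + (K * (hi - lo) + \<mu>) * \<bar>opt (x n) - Z\<bar>)
        \<longlonglongrightarrow> K * \<bar>c - c\<bar> + (K * (hi - lo) + \<mu>) * \<bar>Z - Z\<bar>"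
      using oZ xc by (intro tendsto_intros)
    then have null: "(\<lambda>n. K * \<bar>x n - c\<bar> + (K * (hi - lo) + \<mu>) * \<bar>opt (x n) - Z\<bar>) \<longlonglongrightarrow> 0"
      by simp
    have "(\<lambda>n. stage_value g (x n) (opt (x n)) - stage_value g c Z) \<longlonglongrightarrow> 0"
      by (rule Lim_null_comparison[OF _ null]) (simp add: stage_value_Lipschitz)
    then have 1: "(\<lambda>n. stage_value g (x n) (opt (x n))) \<longlonglongrightarrow> stage_value g c Z"
      by (rule LIM_zero_cancel)
    have "stage_value g (x n) (opt (x n)) = stage_max (x n)" for n
      using stage_feasible_ge_0[OF fx[of n]] by (simp add: stage_max_def)
    moreover have "(\<lambda>n. stage_max (x n)) \<longlonglongrightarrow> stage_max c"
      by (rule continuous_on_tendsto_compose[OF stage_fun_continuous[OF stage_fun_stage_max, of UNIV] xc]) auto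
    ultimately show ?thesis using 1 LIMSEQ_unique by auto
  qed
  ultimately have "Z = opt c" using optimizer_unique[OF c(2)] by blast
  moreover have "(\<lambda>n. dist (opt (x n)) (opt c)) \<longlonglongrightarrow> dist Z (opt c)" using oZ by (intro tendsto_intros)
  then have "e \<le> dist Z (opt c)"
    by (rule LIMSEQ_le_const) (use s(2) in \<open>auto simp: x_def\<close>)
  ultimately show False using e(1) by simp
qed

lemma opt_measurable: "(\<lambda>c. if c < 0 then 0 else opt c) \<in> borel_measurable borel"
proof -
  have "continuous_on (- exceptional) (\<lambda>c. if c < 0 then 0 else opt c)"
    unfolding continuous_on_sequentially
  proof (intro allI ballI impI, elim conjE)
    fix X c assume c: "c \<in> - exceptional" and XN: "\<forall>n. X n \<in> - exceptional" and X: "X \<longlonglongrightarrow> c"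
    have "c \<noteq> 0" using c by (auto simp: exceptional_def)
    then consider "c < 0" | "0 < c" by linarith
    then show "((\<lambda>c. if c < 0 then 0 else opt c) \<circ> X) \<longlonglongrightarrow> (if c < 0 then 0 else opt c)"
    proof cases
      case 1
      then have "\<forall>\<^sub>F n in sequentially. X n < 0" using X by (auto intro: order_tendstoD)
      then show ?thesis using 1 by (auto simp: o_def intro!: tendsto_eventually elim!: eventually_mono)
    next
      case 2
      then have ev: "\<forall>\<^sub>F n in sequentially. 0 < X n" using X by (auto intro: order_tendstoD)
      \<comment> \<open>Only finitely many terms change; this supplies the positivity at every index
        that \<open>opt_tendsto\<close> demands.\<close>
      define X' where "X' n = (if 0 < X n then X n else c)" for n
      have "X' \<longlonglongrightarrow> c"
        using ev by (intro tendsto_cong[THEN iffD2, OF _ X]) (auto simp: X'_def elim!: eventually_mono)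
      moreover have "0 < X' n" for n using 2 by (simp add: X'_def)
      ultimately have "(\<lambda>n. opt (X' n)) \<longlonglongrightarrow> opt c" using 2 c by (intro opt_tendsto) auto
      moreover have "\<forall>\<^sub>F n in sequentially. opt (X' n) = (if X n < 0 then 0 else opt (X n))"
        using ev by (auto simp: X'_def elim!: eventually_mono)
      ultimately show ?thesis using 2 by (simp add: o_def tendsto_cong)
    qed
  qed
  moreover have "countable exceptional" unfolding exceptional_def using countable_kinks by simp
  ultimately show ?thesis using borel_measurable_continuous_countable_exceptions by blast
qed

end

subsection \<open>Tail sums over the remaining days\<close>

text \<open>\<open>B\<close> may have an infinite integral. Then
  \<open>B \<le> A + max 0 (B - A)\<close> forces the negative part of \<open>A - B\<close> to be
  infinite too, since \<open>A\<close> is integrable.\<close>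

lemma expect_diff:
  assumes [measurable]: "A \<in> borel_measurable M" "B \<in> borel_measurable M"
    and nonneg: "AE w in M. 0 \<le> A w \<and> 0 \<le> B w" and fin: "(\<integral>\<^sup>+ w. ennreal (A w) \<partial>M) < \<infinity>"
  shows "expect M (\<lambda>w. ereal (A w - B w))
    = enn2ereal (\<integral>\<^sup>+ w. ennreal (A w) \<partial>M) - enn2ereal (\<integral>\<^sup>+ w. ennreal (B w) \<partial>M)"
proof (cases "(\<integral>\<^sup>+ w. ennreal (B w) \<partial>M) = \<infinity>")
  case True
  have "(\<integral>\<^sup>+ w. ennreal (B w) \<partial>M) \<le> (\<integral>\<^sup>+ w. ennreal (A w) + ennreal (B w - A w) \<partial>M)"
  proof (rule nn_integral_mono_AE)
    show "AE w in M. ennreal (B w) \<le> ennreal (A w) + ennreal (B w - A w)"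
      using nonneg
    proof eventually_elim
      case (elim w)
      have "ennreal (B w) \<le> ennreal (A w + max 0 (B w - A w))" by (intro ennreal_leI) auto
      also have "\<dots> = ennreal (A w) + ennreal (max 0 (B w - A w))" using elim by simp
      also have "ennreal (max 0 (B w - A w)) = ennreal (B w - A w)" by (simp add: max_def ennreal_neg)
      finally show ?case .
    qed
  qed
  also have "\<dots> = (\<integral>\<^sup>+ w. ennreal (A w) \<partial>M) + (\<integral>\<^sup>+ w. ennreal (B w - A w) \<partial>M)"
    by (rule nn_integral_add) auto
  finally have "(\<integral>\<^sup>+ w. ennreal (B w - A w) \<partial>M) = \<infinity>"
    using True fin by (auto simp: top.extremum_unique ennreal_add_eq_top less_top)
  moreover have "(\<integral>\<^sup>+ w. ennreal (A w - B w) \<partial>M) \<le> (\<integral>\<^sup>+ w. ennreal (A w) \<partial>M)"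
    by (rule nn_integral_mono_AE, rule eventually_mono[OF nonneg]) (auto intro!: ennreal_leI)
  then have "(\<integral>\<^sup>+ w. ennreal (A w - B w) \<partial>M) < \<infinity>" using fin by (rule le_less_trans)
  ultimately have "expect M (\<lambda>w. ereal (A w - B w)) = - \<infinity>"
    by (intro expect_eq_MInf) (simp_all add: e2ennreal_ereal)
  moreover have "enn2ereal (\<integral>\<^sup>+ w. ennreal (A w) \<partial>M) \<noteq> \<infinity>"
    using fin by (cases "\<integral>\<^sup>+ w. ennreal (A w) \<partial>M") auto
  ultimately show ?thesis
    using True by (cases "enn2ereal (\<integral>\<^sup>+ w. ennreal (A w) \<partial>M)") auto
next
  case False
  have int: "integrable M A" "integrable M B"
    using fin False nonneg by (auto intro!: integrableI_nonneg elim!: eventually_mono simp: less_top)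
  have eq: "enn2ereal (\<integral>\<^sup>+ w. ennreal (h w) \<partial>M) = ereal (integral\<^sup>L M h)"
    if "integrable M h" "AE w in M. 0 \<le> h w" for h
    using that by (simp add: nn_integral_eq_integral enn2ereal_ennreal integral_nonneg_AE)
  have "expect M (\<lambda>w. ereal (A w - B w)) = ereal (\<integral>w. A w - B w \<partial>M)"
    using int by (intro expect_integrable) auto
  also have "\<dots> = ereal (integral\<^sup>L M A) - ereal (integral\<^sup>L M B)" using int by simp
  also have "\<dots> = enn2ereal (\<integral>\<^sup>+ w. ennreal (A w) \<partial>M) - enn2ereal (\<integral>\<^sup>+ w. ennreal (B w) \<partial>M)"
    using nonneg by (subst (1 2) eq) (auto intro: int elim!: eventually_mono)
  finally show ?thesis .
qed

locale market =
  fixes k :: nat and lo hi :: "nat \<Rightarrow> real" and f :: "nat \<Rightarrow> real \<Rightarrow> real"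
  assumes day_dist: "\<And>i. i \<in> {1..k} \<Longrightarrow> value_dist (prior f i) (lo i) (hi i)"
begin

text \<open>Days outside \<open>{1..k}\<close> get a dummy distribution so that products over all days make sense.\<close>

definition vals :: "nat \<Rightarrow> real measure" where
  "vals i = (if i \<in> {1..k} then prior f i else return borel 0)"

lemma sets_vals [measurable_cong, simp]: "sets (vals i) = sets borel"
  using value_dist.sets_D[OF day_dist, of i] by (simp add: vals_def)

lemma space_vals [simp]: "space (vals i) = UNIV"
  using sets_eq_imp_space_eq[OF sets_vals] by simp

lemma prob_space_vals: "prob_space (vals i)"
  using day_dist by (auto simp: vals_def value_dist_def intro!: prob_space_return)

sublocale product_prob_space vals UNIV
  by (intro product_prob_spaceI prob_space_vals)

lemma value_dist_vals: "i \<in> {1..k} \<Longrightarrow> value_dist (vals i) (lo i) (hi i)"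
  using day_dist by (simp add: vals_def)

lemma PiM_prior: "I \<subseteq> {1..k} \<Longrightarrow> PiM I (prior f) = PiM I vals"
  by (intro PiM_cong) (auto simp: vals_def)

abbreviation "hist i \<equiv> histories lo hi i"
abbreviation "reports i \<equiv> \<Pi>\<^sub>M j\<in>{1..i}. (borel :: real measure)"
abbreviation "continue i v w \<equiv> merge {1..i} {i<..k} (v, w)"

lemma sets_PiM_vals [measurable_cong]: "sets (PiM I vals) = sets (PiM I (\<lambda>_. borel))"
  by (intro sets_PiM_cong) auto

lemma hist_sets [measurable]: "hist i \<in> sets (reports i)"
  unfolding histories_def by (intro sets_PiM_I_finite) auto

lemma hist_extensional: "v \<in> hist i \<Longrightarrow> v \<in> extensional {1..i}"
  by (auto simp: histories_def PiE_def)

lemma hist_Suc: "v \<in> hist i \<Longrightarrow> y \<in> {lo (Suc i)..hi (Suc i)} \<Longrightarrow> v(Suc i := y) \<in> hist (Suc i)"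
  unfolding histories_def
  by (auto simp: PiE_def extensional_def Pi_iff le_Suc_eq)

lemma hist_0: "(\<lambda>_. undefined) \<in> hist 0"
  by (auto simp: histories_def)

lemma AE_vals: "i \<in> {1..k} \<Longrightarrow> AE y in vals i. y \<in> {lo i..hi i}"
  using value_dist.AE_in[OF value_dist_vals] .

lemma AE_continue:
  assumes v: "v \<in> hist i"
  shows "AE w in PiM {i<..k} vals. \<forall>j\<in>{i<..k}. restrict (continue i v w) {1..j} \<in> hist j"
proof -
  have "AE w in PiM {i<..k} vals. w l \<in> {lo l..hi l}" if "l \<in> {i<..k}" for l
    using that by (intro AE_PiM_component[where P = "\<lambda>y. y \<in> {lo l..hi l}"] prob_space_vals AE_vals) auto
  then have "AE w in PiM {i<..k} vals. \<forall>l\<in>{i<..k}. w l \<in> {lo l..hi l}"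
    by (intro AE_finite_allI) auto
  then show ?thesis
  proof eventually_elim
    case (elim w)
    have "continue i v w l \<in> {lo l..hi l}" if "1 \<le> l" "l \<le> k" for l
    proof (cases "l \<le> i")
      case True
      then show ?thesis using v that by (auto simp: merge_def histories_def PiE_def Pi_iff)
    next
      case False
      then show ?thesis using elim that by (auto simp: merge_def)
    qed
    then show ?case by (auto simp: histories_def)
  qed
qed

text \<open>Nonnegative extended values let the day-by-day recursion hold without any integrability
  condition.\<close>

definition tail :: "(nat \<Rightarrow> (nat \<Rightarrow> real) \<Rightarrow> ennreal) \<Rightarrow> nat \<Rightarrow> (nat \<Rightarrow> real) \<Rightarrow> ennreal" where
  "tail a i v = (\<integral>\<^sup>+ w. (\<Sum>j\<in>{i<..k}. a j (restrict (continue i v w) {1..j})) \<partial>PiM {i<..k} vals)"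

definition measurable_policy :: "(nat \<Rightarrow> (nat \<Rightarrow> real) \<Rightarrow> ennreal) \<Rightarrow> bool" where
  "measurable_policy a \<longleftrightarrow> (\<forall>j\<in>{1..k}. a j \<in> borel_measurable (reports j))"

lemma measurable_continue:
  assumes "j \<le> k"
  shows "(\<lambda>(v, w). restrict (continue i v w) {1..j}) \<in> reports i \<Otimes>\<^sub>M PiM {i<..k} vals \<rightarrow>\<^sub>M reports j"
proof -
  have m: "merge {1..i} {i<..k} \<in> reports i \<Otimes>\<^sub>M PiM {i<..k} vals \<rightarrow>\<^sub>M PiM ({1..i} \<union> {i<..k}) (\<lambda>_. borel :: real measure)"
    by (subst measurable_cong_sets[OF sets_pair_measure_cong[OF refl sets_PiM_vals] refl]) (rule measurable_merge)
  have "(\<lambda>u. restrict u {1..j}) \<in> PiM ({1..i} \<union> {i<..k}) (\<lambda>_. borel :: real measure) \<rightarrow>\<^sub>M reports j"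
    using assms by (intro measurable_restrict_subset) auto
  from measurable_compose[OF m this] show ?thesis by (simp add: case_prod_unfold)
qed

lemma tail_measurable:
  assumes "measurable_policy a"
  shows "tail a i \<in> borel_measurable (reports i)"
proof -
  interpret R: prob_space "PiM {i<..k} vals" by (intro prob_space_PiM prob_space_vals)
  have "(\<lambda>(v, w). \<Sum>j\<in>{i<..k}. a j (restrict (continue i v w) {1..j}))
      \<in> borel_measurable (reports i \<Otimes>\<^sub>M PiM {i<..k} vals)"
    unfolding case_prod_unfold
  proof (intro borel_measurable_sum)
    fix j assume j: "j \<in> {i<..k}"
    then have "a j \<in> borel_measurable (reports j)" using assms by (auto simp: measurable_policy_def)
    from measurable_compose[OF measurable_continue this] j
    show "(\<lambda>x. a j (restrict (continue i (fst x) (snd x)) {1..j})) \<in> borel_measurable (reports i \<Otimes>\<^sub>M PiM {i<..k} vals)"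
      by (simp add: case_prod_unfold)
  qed
  then show ?thesis unfolding tail_def by (rule R.borel_measurable_nn_integral)
qed

lemma measurable_continue_right:
  assumes "u \<in> extensional {1..n}" "j \<le> k"
  shows "(\<lambda>w. restrict (continue n u w) {1..j}) \<in> PiM {n<..k} vals \<rightarrow>\<^sub>M reports j"
proof -
  have "u \<in> space (reports n)" using assms(1) by (auto simp: space_PiM PiE_def)
  then have "Pair u \<in> PiM {n<..k} vals \<rightarrow>\<^sub>M reports n \<Otimes>\<^sub>M PiM {n<..k} vals" by (rule measurable_Pair1')
  from measurable_compose[OF this measurable_continue[OF assms(2)]] show ?thesis by simp
qed

lemma measurable_append:
  assumes "v \<in> extensional {1..i}"
  shows "(\<lambda>y. v(Suc i := y)) \<in> borel \<rightarrow>\<^sub>M reports (Suc i)"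
proof (rule measurable_PiM_single')
  fix l show "(\<lambda>y. (v(Suc i := y)) l) \<in> borel \<rightarrow>\<^sub>M borel" by (cases "l = Suc i") auto
next
  show "(\<lambda>y. v(Suc i := y)) \<in> space borel \<rightarrow> (\<Pi>\<^sub>E j\<in>{1..Suc i}. space (borel :: real measure))"
    using assms by (auto simp: extensional_def)
qed

lemma tail_k: "tail a k v = 0"
  by (simp add: tail_def)

text \<open>Tonelli with day \<open>Suc i\<close> as the outer integral. Extensionality of
  \<open>v\<close> makes the restricted merged history equal to \<open>v(Suc i := y)\<close>
  literally.\<close>

lemma tail_Suc:
  assumes a: "measurable_policy a" and i: "i < k" and v: "v \<in> extensional {1..i}"
  shows "tail a i v = (\<integral>\<^sup>+ y. a (Suc i) (v(Suc i := y)) + tail a (Suc i) (v(Suc i := y)) \<partial>vals (Suc i))"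
proof -
  let ?J = "{Suc i<..k}"
  interpret J: prob_space "PiM ?J vals" by (intro prob_space_PiM prob_space_vals)
  define F where "F w = (\<Sum>j\<in>{i<..k}. a j (restrict (continue i v w) {1..j}))" for w
  have ins: "{i<..k} = insert (Suc i) ?J" using i by auto
  have meas: "(\<lambda>w. \<Sum>j\<in>J. a j (restrict (continue n u w) {1..j})) \<in> borel_measurable (PiM {n<..k} vals)"
    if "J \<subseteq> {n<..k}" "u \<in> extensional {1..n}" for n u J
  proof (intro borel_measurable_sum)
    fix j assume "j \<in> J"
    then have j: "j \<in> {n<..k}" using that by auto
    then have aj: "a j \<in> borel_measurable (reports j)" using a by (auto simp: measurable_policy_def)
    show "(\<lambda>w. a j (restrict (continue n u w) {1..j})) \<in> borel_measurable (PiM {n<..k} vals)" 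
      by (rule measurable_compose[OF measurable_continue_right aj]) (use that(2) j in auto)
  qed
  have S: "(\<Sum>j\<in>{i<..k}. h j) = h (Suc i) + (\<Sum>j\<in>?J. h j)" for h :: "nat \<Rightarrow> ennreal"
    by (simp add: ins)
  have F: "F \<in> borel_measurable (PiM {i<..k} vals)"
    unfolding F_def[abs_def] by (rule meas) (use v in auto)
  have upd: "v(Suc i := y) \<in> extensional {1..Suc i}" for y using v by (auto simp: extensional_def)
  have sp: "restrict (continue i v (x(Suc i := y))) {1..j} = restrict (continue (Suc i) (v(Suc i := y)) x) {1..j}" for x y j
    using i by (auto simp: restrict_def merge_def fun_eq_iff)
  have head: "restrict (continue (Suc i) (v(Suc i := y)) x) {1..Suc i} = v(Suc i := y)" for x y
    using upd[of y] by (auto simp: restrict_def merge_def fun_eq_iff extensional_def)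
  have "tail a i v = (\<integral>\<^sup>+ w. F w \<partial>PiM (insert (Suc i) ?J) vals)"
    unfolding ins[symmetric] tail_def F_def ..
  also have "\<dots> = (\<integral>\<^sup>+ y. (\<integral>\<^sup>+ x. F (x(Suc i := y)) \<partial>PiM ?J vals) \<partial>vals (Suc i))"
    using F unfolding ins by (intro product_nn_integral_insert_rev) auto
  also have "\<dots> = (\<integral>\<^sup>+ y. a (Suc i) (v(Suc i := y)) + tail a (Suc i) (v(Suc i := y)) \<partial>vals (Suc i))"
  proof (intro nn_integral_cong)
    fix y
    have "F (x(Suc i := y)) = a (Suc i) (v(Suc i := y))
      + (\<Sum>j\<in>?J. a j (restrict (continue (Suc i) (v(Suc i := y)) x) {1..j}))" for x
      unfolding F_def sp S head ..
    then have "(\<integral>\<^sup>+ x. F (x(Suc i := y)) \<partial>PiM ?J vals) = (\<integral>\<^sup>+ x. a (Suc i) (v(Suc i := y)) \<partial>PiM ?J vals)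
        + (\<integral>\<^sup>+ x. (\<Sum>j\<in>?J. a j (restrict (continue (Suc i) (v(Suc i := y)) x) {1..j})) \<partial>PiM ?J vals)"
      using meas[OF order_refl upd] by (simp add: nn_integral_add)
    then show "(\<integral>\<^sup>+ x. F (x(Suc i := y)) \<partial>PiM ?J vals) = a (Suc i) (v(Suc i := y)) + tail a (Suc i) (v(Suc i := y))"
      by (simp add: tail_def J.emeasure_space_1)
  qed
  finally show ?thesis .
qed

subsection \<open>Mechanisms\<close>

text \<open>A mechanism is measurable only on valid histories; extension by 0 makes it measurable on
  the whole product space and changes nothing almost surely.\<close>

definition cut :: "policy \<Rightarrow> nat \<Rightarrow> (nat \<Rightarrow> real) \<Rightarrow> ennreal" where
  "cut a j v = ennreal (if v \<in> hist j then a j v else 0)"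

lemma cut_measurable:
  assumes "a j \<in> borel_measurable (restrict_space (reports j) (hist j))"
  shows "(\<lambda>v. if v \<in> hist j then a j v else 0) \<in> borel_measurable (reports j)"
  using assms by (subst measurable_restrict_space_iff[OF sets.Int[OF hist_sets sets.top], symmetric]) auto

lemma tail_cut:
  assumes "v \<in> hist i"
    and nonneg: "\<And>j v. j \<in> {1..k} \<Longrightarrow> v \<in> hist j \<Longrightarrow> 0 \<le> a j v"
  shows "tail (cut a) i v
    = (\<integral>\<^sup>+ w. ennreal (\<Sum>j\<in>{i<..k}. a j (restrict (continue i v w) {1..j})) \<partial>PiM {i<..k} vals)"
  unfolding tail_def
proof (rule nn_integral_cong_AE)
  show "AE w in PiM {i<..k} vals. (\<Sum>j\<in>{i<..k}. cut a j (restrict (continue i v w) {1..j}))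
      = ennreal (\<Sum>j\<in>{i<..k}. a j (restrict (continue i v w) {1..j}))"
    using AE_continue[OF assms(1)]
  proof eventually_elim
    case (elim w)
    have "(\<Sum>j\<in>{i<..k}. cut a j (restrict (continue i v w) {1..j}))
        = (\<Sum>j\<in>{i<..k}. ennreal (a j (restrict (continue i v w) {1..j})))"
      using elim by (intro sum.cong) (auto simp: cut_def)
    also have "\<dots> = ennreal (\<Sum>j\<in>{i<..k}. a j (restrict (continue i v w) {1..j}))"
      using elim by (intro sum_ennreal nonneg) auto
    finally show ?case .
  qed
qed

lemma expect_tail:
  assumes "v \<in> hist i"
    and nonneg: "\<And>j v. j \<in> {1..k} \<Longrightarrow> v \<in> hist j \<Longrightarrow> 0 \<le> a j v"
  shows "expect (PiM {i<..k} (prior f)) (\<lambda>w. ereal (\<Sum>j\<in>{i<..k}. a j (restrict (continue i v w) {1..j})))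
    = enn2ereal (tail (cut a) i v)"
proof -
  have sub: "{i<..k} \<subseteq> {1..k}" by auto
  have "AE w in PiM {i<..k} vals. 0 \<le> ereal (\<Sum>j\<in>{i<..k}. a j (restrict (continue i v w) {1..j}))"
    using AE_continue[OF assms(1)]
  proof eventually_elim
    case (elim w)
    have "0 \<le> (\<Sum>j\<in>{i<..k}. a j (restrict (continue i v w) {1..j}))"
      using elim by (intro sum_nonneg nonneg) auto
    then show ?case by simp
  qed
  then show ?thesis
    unfolding PiM_prior[OF sub] by (simp only: expect_nonneg tail_cut[of v i a, OF assms] e2ennreal_ereal)
qed

definition sales :: "policy \<Rightarrow> policy" where
  "sales x j v = v j * x j v"

definition utility :: "policy \<Rightarrow> policy \<Rightarrow> policy" where
  "utility x p j v = v j * x j v - p j v"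

abbreviation "start \<equiv> (\<lambda>_. undefined) :: nat \<Rightarrow> real"

lemma is_mechanismD:
  assumes "is_mechanism k lo hi x p" "j \<in> {1..k}"
  shows "x j \<in> borel_measurable (restrict_space (reports j) (hist j))"
    "p j \<in> borel_measurable (restrict_space (reports j) (hist j))"
    "v \<in> hist j \<Longrightarrow> 0 \<le> x j v" "v \<in> hist j \<Longrightarrow> x j v \<le> 1"
  using assms by (auto simp: is_mechanism_def)

lemma measurable_report:
  assumes "j \<in> {1..n}"
  shows "(\<lambda>v. v j) \<in> borel_measurable (restrict_space (reports n) (hist n))"
  using assms by (intro measurable_restrict_space1 measurable_component_singleton)

lemma sales_utility_measurable:
  assumes m: "is_mechanism k lo hi x p" and j: "j \<in> {1..k}"
  shows "sales x j \<in> borel_measurable (restrict_space (reports j) (hist j))"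
    "utility x p j \<in> borel_measurable (restrict_space (reports j) (hist j))"
proof -
  have "(\<lambda>v. v j) \<in> borel_measurable (restrict_space (reports j) (hist j))"
    using j by (intro measurable_report) auto
  then show "sales x j \<in> borel_measurable (restrict_space (reports j) (hist j))"
    "utility x p j \<in> borel_measurable (restrict_space (reports j) (hist j))"
    unfolding sales_def[abs_def] utility_def[abs_def]
    using is_mechanismD(1,2)[OF m j] by (auto intro!: borel_measurable_times borel_measurable_diff)
qed

lemma hist_report:
  assumes "v \<in> hist n" "j \<in> {1..n}"
  shows "v j \<in> {lo j..hi j}"
  using assms unfolding histories_def by (rule PiE_mem)

lemma lo_nonneg: "j \<in> {1..k} \<Longrightarrow> 0 \<le> lo j"
  using day_dist by (rule value_dist.lo_nonneg)

lemma sales_bounds: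
  assumes m: "is_mechanism k lo hi x p" and j: "j \<in> {1..k}" and v: "v \<in> hist j"
  shows "0 \<le> sales x j v" "sales x j v \<le> hi j"
proof -
  have vj: "0 \<le> v j" "v j \<le> hi j" using hist_report[OF v, of j] lo_nonneg[OF j] j by auto
  show "0 \<le> sales x j v" using vj is_mechanismD[OF m j] v by (simp add: sales_def)
  have "v j * x j v \<le> hi j * 1" using vj is_mechanismD[OF m j] v by (intro mult_mono) auto
  then show "sales x j v \<le> hi j" by (simp add: sales_def)
qed

lemma utility_nonneg:
  "ex_post_IR k lo hi x p \<Longrightarrow> j \<in> {1..k} \<Longrightarrow> v \<in> hist j \<Longrightarrow> 0 \<le> utility x p j v"
  by (simp add: ex_post_IR_def utility_def)

lemma measurable_policy_cut:
  assumes "\<And>j. j \<in> {1..k} \<Longrightarrow> a j \<in> borel_measurable (restrict_space (reports j) (hist j))"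
  shows "measurable_policy (cut a)"
  unfolding measurable_policy_def cut_def
  by (intro ballI measurable_compose[OF cut_measurable[of a] measurable_ennreal] assms)

lemma continuation_eq:
  assumes ir: "ex_post_IR k lo hi x p" and v: "v \<in> hist i"
  shows "continuation k f x p i v = enn2ereal (tail (cut (utility x p)) i v)"
proof -
  have "(\<Sum>j\<in>{i<..k}. w j * x j (restrict (continue i v w) {1..j}) - p j (restrict (continue i v w) {1..j}))
      = (\<Sum>j\<in>{i<..k}. utility x p j (restrict (continue i v w) {1..j}))" for w
    by (intro sum.cong) (auto simp: utility_def merge_def)
  then show ?thesis
    unfolding continuation_def using utility_nonneg[OF ir] v by (simp only: expect_tail)
qed

lemma tail_sales_finite:
  assumes m: "is_mechanism k lo hi x p" and v: "v \<in> hist i"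
  shows "tail (cut (sales x)) i v < \<infinity>"
proof -
  interpret T: prob_space "PiM {i<..k} vals" by (intro prob_space_PiM prob_space_vals)
  have "tail (cut (sales x)) i v \<le> (\<integral>\<^sup>+ w. (\<Sum>j\<in>{i<..k}. ennreal (max 0 (hi j))) \<partial>PiM {i<..k} vals)"
    unfolding tail_def
    using sales_bounds[OF m]
    by (intro nn_integral_mono sum_mono) (auto simp: cut_def intro!: ennreal_leI max.coboundedI2)
  also have "\<dots> < \<infinity>" by (simp add: T.emeasure_space_1 less_top)
  finally show ?thesis .
qed

text \<open>Each payment is sales minus utility. Sales have a finite integral and utility is
  nonnegative, so the expectation splits even if the utility is infinite, in which case the revenue
  is -\<infinity>.\<close>

lemma revenue_eq:
  assumes m: "is_mechanism k lo hi x p" and ir: "ex_post_IR k lo hi x p"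
  shows "revenue k f p
    = enn2ereal (tail (cut (sales x)) 0 start) - enn2ereal (tail (cut (utility x p)) 0 start)"
proof -
  have days: "{0<..k} = {1..k}" by auto
  define r where "r j w = restrict (continue 0 start w) {1..j}" for j w
  have r: "r j \<in> PiM {0<..k} vals \<rightarrow>\<^sub>M reports j" if "j \<le> k" for j
    unfolding r_def using that by (intro measurable_continue_right) auto
  have r_eq: "r j w = restrict w {1..j}" if "j \<in> {1..k}" for j w
    using that by (auto simp: r_def restrict_def merge_def fun_eq_iff)
  define A where "A w = (\<Sum>j\<in>{0<..k}. (if r j w \<in> hist j then sales x j (r j w) else 0))" for w
  define B where "B w = (\<Sum>j\<in>{0<..k}. (if r j w \<in> hist j then utility x p j (r j w) else 0))" for w
  have meas: "(\<lambda>w. \<Sum>j\<in>{0<..k}. (if r j w \<in> hist j then a j (r j w) else 0)) \<in> borel_measurable (PiM {0<..k} vals)"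
    if "\<And>j. j \<in> {1..k} \<Longrightarrow> a j \<in> borel_measurable (restrict_space (reports j) (hist j))"
    for a :: policy
    using that by (intro borel_measurable_sum measurable_compose[OF r cut_measurable]) auto
  have AB: "A \<in> borel_measurable (PiM {0<..k} vals)" "B \<in> borel_measurable (PiM {0<..k} vals)"
    unfolding A_def[abs_def] B_def[abs_def] using sales_utility_measurable[OF m] by (intro meas; simp)+
  have cut_sum: "(\<Sum>j\<in>{0<..k}. cut a j (r j w)) = ennreal (\<Sum>j\<in>{0<..k}. (if r j w \<in> hist j then a j (r j w) else 0))"
    if "\<And>j v. j \<in> {1..k} \<Longrightarrow> v \<in> hist j \<Longrightarrow> 0 \<le> a j v" for a :: policy and w
    unfolding cut_def using that by (intro sum_ennreal) auto
  have tA: "tail (cut (sales x)) 0 start = (\<integral>\<^sup>+ w. ennreal (A w) \<partial>PiM {0<..k} vals)"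
    unfolding tail_def A_def r_def[symmetric] by (simp only: cut_sum[OF sales_bounds(1)[OF m]])
  have tB: "tail (cut (utility x p)) 0 start = (\<integral>\<^sup>+ w. ennreal (B w) \<partial>PiM {0<..k} vals)"
    unfolding tail_def B_def r_def[symmetric] by (simp only: cut_sum[OF utility_nonneg[OF ir]])
  have AE_r: "AE w in PiM {0<..k} vals. \<forall>j\<in>{0<..k}. r j w \<in> hist j"
    using AE_continue[OF hist_0] by (simp add: r_def)
  have nonneg: "AE w in PiM {0<..k} vals. 0 \<le> A w \<and> 0 \<le> B w"
    unfolding A_def B_def using sales_bounds[OF m] utility_nonneg[OF ir]
    by (intro always_eventually allI conjI sum_nonneg) auto
  have "revenue k f p = expect (PiM {0<..k} vals) (\<lambda>w. ereal (\<Sum>j\<in>{0<..k}. p j (restrict w {1..j})))"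
    unfolding revenue_def days using PiM_prior[of "{1..k}"] by simp
  also have "\<dots> = expect (PiM {0<..k} vals) (\<lambda>w. ereal (A w - B w))"
  proof (rule expect_cong_AE)
    show "AE w in PiM {0<..k} vals. ereal (\<Sum>j\<in>{0<..k}. p j (restrict w {1..j})) = ereal (A w - B w)"
      using AE_r
    proof eventually_elim
      case (elim w)
      have "(\<Sum>j\<in>{0<..k}. p j (restrict w {1..j})) = (\<Sum>j\<in>{0<..k}. sales x j (r j w) - utility x p j (r j w))"
        by (intro sum.cong) (auto simp: sales_def utility_def r_eq)
      also have "\<dots> = A w - B w"
        unfolding A_def B_def sum_subtractf[symmetric] using elim by (intro sum.cong) auto
      finally show ?case by simp
    qed
  qed
  also have "\<dots> = enn2ereal (\<integral>\<^sup>+ w. ennreal (A w) \<partial>PiM {0<..k} vals) - enn2ereal (\<integral>\<^sup>+ w. ennreal (B w) \<partial>PiM {0<..k} vals)"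
    using tail_sales_finite[OF m hist_0] by (intro expect_diff AB nonneg) (simp add: tA)
  finally show ?thesis unfolding tA tB .
qed

end

subsection \<open>The recursion\<close>

locale optimized_market = market +
  fixes Y :: "nat \<Rightarrow> real \<Rightarrow> real"
  assumes optimizer: "\<And>i c. i \<in> {1..k} \<Longrightarrow> is_stage_optimizer k f i c (Y i c)"
begin

definition val :: "nat \<Rightarrow> real \<Rightarrow> real" where
  "val i c = (if c < 0 then 0 else real_of_ereal (hhat k f i c))"

lemma hhat_last: "hhat k f (Suc k) c = (if c < 0 then - \<infinity> else 0)"
  by (simp add: hhat.simps[of k f "Suc k"])

text \<open>For \<open>c \<ge> 0\<close> the choice \<open>Y = 0\<close> is feasible with a finite
  objective, while infeasible choices give -\<infinity>; hence every optimizer is feasible. For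
  \<open>c < 0\<close> no choice is feasible.\<close>

lemma hhat_step:
  assumes i: "i \<in> {1..k}" and g: "stage_fun K (val (Suc i))"
    and h: "\<And>c. hhat k f (Suc i) c = (if c < 0 then - \<infinity> else ereal (val (Suc i) c))"
  shows "optimal_stage (prior f i) (lo i) (hi i) K (val (Suc i)) (Y i)"
    and "hhat k f i c = (if c < 0 then - \<infinity> else ereal (value_dist.stage_value (prior f i) (val (Suc i)) c (Y i c)))"
proof -
  interpret value_dist "prior f i" "lo i" "hi i" by (rule day_dist[OF i])
  let ?obj = "stage_objective (prior f i) (hhat k f (Suc i))"
  have Y: "0 \<le> Y i c" "Y i c \<le> 1" and best: "\<And>z. 0 \<le> z \<Longrightarrow> z \<le> 1 \<Longrightarrow> ?obj c z \<le> ?obj c (Y i c)" for c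
    using optimizer[OF i] by (auto simp: is_stage_optimizer_def)
  note feas = stage_objective_feasible[OF g h]
  note infeas = stage_objective_infeasible[OF g h]
  have feasY: "stage_feasible c (Y i c)" if "0 \<le> c" for c
  proof (rule ccontr)
    assume "\<not> stage_feasible c (Y i c)"
    then have "?obj c (Y i c) = - \<infinity>" by (intro infeas Y)
    moreover have "?obj c 0 = ereal (stage_value (val (Suc i)) c 0)"
      by (intro feas) (use that in \<open>simp add: stage_feasible_def\<close>)
    ultimately show False using best[of 0 c] by simp
  qed
  have bestY: "stage_value (val (Suc i)) c Z \<le> stage_value (val (Suc i)) c (Y i c)" if Z: "stage_feasible c Z" for c Z
  proof -
    have "0 \<le> c" using Z by (rule stage_feasible_ge_0)
    then show ?thesis using best[of Z c] feas[OF Z] feas[OF feasY] Z by (simp add: stage_feasible_def)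
  qed
  show "optimal_stage (prior f i) (lo i) (hi i) K (val (Suc i)) (Y i)"
    by unfold_locales (fact g feasY bestY)+
  have sup: "hhat k f i c = ?obj c (Y i c)" for c
  proof -
    have "hhat k f i c = (SUP z\<in>{0..1}. ?obj c z)"
      using i by (subst hhat.simps) simp
    also have "\<dots> = ?obj c (Y i c)"
      using Y best by (intro antisym SUP_least SUP_upper) auto
    finally show ?thesis .
  qed
  show "hhat k f i c = (if c < 0 then - \<infinity> else ereal (stage_value (val (Suc i)) c (Y i c)))"
  proof (cases "c < 0")
    case True
    then have "\<not> stage_feasible c (Y i c)" using stage_feasible_ge_0[of c "Y i c"] by auto
    then show ?thesis using True sup infeas[OF Y] by simp
  next
    case False
    then show ?thesis using sup feas[OF feasY] by simp
  qed
qed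

lemma val_stage_fun:
  assumes "i \<le> Suc k" "1 \<le> i"
  shows "(\<exists>K. stage_fun K (val i)) \<and> (\<forall>c. hhat k f i c = (if c < 0 then - \<infinity> else ereal (val i c)))"
  using assms
proof (induction i rule: inc_induct)
  case base
  have "val (Suc k) = (\<lambda>_. 0)" by (auto simp: val_def hhat_last)
  then show ?case by (auto simp: hhat_last stage_fun_def concave_on_const mono_def intro!: exI[of _ 0])
next
  case (step i)
  then obtain K where K: "stage_fun K (val (Suc i))"
    and h: "\<And>c. hhat k f (Suc i) c = (if c < 0 then - \<infinity> else ereal (val (Suc i) c))" by auto
  have i: "i \<in> {1..k}" using step by auto
  interpret optimal_stage "prior f i" "lo i" "hi i" K "val (Suc i)" "Y i" by (rule hhat_step(1)[OF i K h])
  have eq: "val i = stage_max" by (auto simp: fun_eq_iff val_def stage_max_def hhat_step(2)[OF i K h])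
  have "hhat k f i c = (if c < 0 then - \<infinity> else ereal (val i c))" for c
    unfolding eq hhat_step(2)[OF i K h] by (simp add: stage_max_def)
  then show ?case using stage_fun_stage_max unfolding eq by blast
qed

lemma optimal_stage_day:
  assumes i: "i \<in> {1..k}"
  shows "\<exists>K. optimal_stage (vals i) (lo i) (hi i) K (val (Suc i)) (Y i)"
  using val_stage_fun[of "Suc i"] hhat_step(1)[OF i] i by (auto simp: vals_def)

lemma val_eq:
  assumes i: "i \<in> {1..k}" and c: "0 \<le> c"
  shows "val i c = value_dist.stage_value (vals i) (val (Suc i)) c (Y i c)"
proof -
  obtain K where K: "stage_fun K (val (Suc i))"
    and h: "\<And>c. hhat k f (Suc i) c = (if c < 0 then - \<infinity> else ereal (val (Suc i) c))"
    using val_stage_fun[of "Suc i"] i by auto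
  show ?thesis using hhat_step(2)[OF i K h, of c] c i by (simp add: val_def vals_def)
qed

lemma val_last: "val (Suc k) c = 0"
  by (simp add: val_def hhat_last)

subsection \<open>The balance mechanism\<close>

abbreviation "bal c \<equiv> balance f Y c"

lemma mean_prior: "i \<in> {1..k} \<Longrightarrow> mean (prior f i) = value_dist.\<mu> (vals i)"
  using value_dist.\<mu>_def[OF value_dist_vals] by (simp add: vals_def)

lemma balance_cong: "(\<And>j. j \<in> {1..i} \<Longrightarrow> v j = v' j) \<Longrightarrow> bal c i v = bal c i v'"
  by (induction i) auto

lemma balance_Suc_upd:
  assumes "Suc i \<in> {1..k}"
  shows "bal c (Suc i) (v(Suc i := y))
    = bal c i v + Y (Suc i) (bal c i v) * (y - value_dist.\<mu> (vals (Suc i)))"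
proof -
  have "bal c i (v(Suc i := y)) = bal c i v" by (rule balance_cong) auto
  then show ?thesis by (simp add: mean_prior[OF assms])
qed

lemma optimizer_feasible:
  "i \<in> {1..k} \<Longrightarrow> 0 \<le> c \<Longrightarrow> value_dist.stage_feasible (vals i) (lo i) c (Y i c)"
  using optimal_stage_day[of i] optimal_stage.opt_feasible by blast

lemma optimizer_range: "i \<in> {1..k} \<Longrightarrow> 0 \<le> Y i c \<and> Y i c \<le> 1"
  using optimizer[of i c] by (simp add: is_stage_optimizer_def)

text \<open>Feasibility of the optimizer at a nonnegative balance keeps the next balance
  nonnegative, on every history and not just almost surely.\<close>

lemma balance_nonneg:
  assumes c: "0 \<le> c" and "v \<in> hist n" "n \<le> k" "i \<le> n"
  shows "0 \<le> bal c i v"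
  using assms(4)
proof (induction i)
  case (Suc i)
  then have i: "Suc i \<in> {1..k}" using assms by auto
  then interpret value_dist "vals (Suc i)" "lo (Suc i)" "hi (Suc i)" by (rule value_dist_vals)
  have "v (Suc i) \<in> {lo (Suc i)..hi (Suc i)}" using assms Suc by (intro hist_report) auto
  from stage_feasible_balance[OF optimizer_feasible[OF i] this] Suc
  show ?case by (simp add: mean_prior[OF i] add.commute)
qed (use c in simp)

lemma balance_measurable:
  assumes c: "0 \<le> c" and n: "n \<le> k" and "i \<le> n"
  shows "bal c i \<in> borel_measurable (restrict_space (reports n) (hist n))"
  using assms(3)
proof (induction i)
  case 0
  then show ?case by (simp add: balance.simps(1)[abs_def])
next
  case (Suc i)
  then have i: "Suc i \<in> {1..k}" using assms by auto
  obtain K where K: "optimal_stage (vals (Suc i)) (lo (Suc i)) (hi (Suc i)) K (val (Suc (Suc i))) (Y (Suc i))"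
    using optimal_stage_day[OF i] by blast
  have [measurable]: "(\<lambda>c. if c < 0 then 0 else Y (Suc i) c) \<in> borel_measurable borel"
    by (rule optimal_stage.opt_measurable[OF K])
  have [measurable]: "bal c i \<in> borel_measurable (restrict_space (reports n) (hist n))"
    using Suc by simp
  have [measurable]: "(\<lambda>v. v (Suc i)) \<in> borel_measurable (restrict_space (reports n) (hist n))"
    using Suc by (intro measurable_report) auto
  \<comment> \<open>The optimizer is patched to 0 on negative arguments, where its measurability is
    not known; balances on valid histories never go there.\<close>
  have m: "(\<lambda>v. (\<lambda>c. if c < 0 then 0 else Y (Suc i) c) (bal c i v) * (v (Suc i) - mean (prior f (Suc i))) + bal c i v)
      \<in> borel_measurable (restrict_space (reports n) (hist n))"
    by measurable
  have "\<not> bal c i v < 0" if "v \<in> hist n" for v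
    using balance_nonneg[OF c that n, of i] Suc by simp
  then show ?case
    by (intro measurable_cong[THEN iffD1, OF _ m]) (auto simp: space_restrict_space)
qed

lemma balance_mechanism:
  assumes c: "0 \<le> c"
  shows "is_mechanism k lo hi (balance_alloc f Y c) (balance_payment k f Y c)"
  unfolding is_mechanism_def
proof (intro ballI conjI)
  fix i assume i: "i \<in> {1..k}"
  obtain K where K: "optimal_stage (vals i) (lo i) (hi i) K (val (Suc i)) (Y i)"
    using optimal_stage_day[OF i] by blast
  have Ym: "(\<lambda>c. if c < 0 then 0 else Y i c) \<in> borel_measurable borel"
    by (rule optimal_stage.opt_measurable[OF K])
  have bm: "bal c (i - 1) \<in> borel_measurable (restrict_space (reports i) (hist i))"
    using i by (intro balance_measurable c) auto
  have "\<not> bal c (i - 1) v < 0" if "v \<in> hist i" for v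
    using balance_nonneg[OF c that, of "i - 1"] i by simp
  then have x: "balance_alloc f Y c i \<in> borel_measurable (restrict_space (reports i) (hist i))"
    by (intro measurable_cong[THEN iffD1, OF _ measurable_compose[OF bm Ym]])
      (auto simp: space_restrict_space balance_alloc_def)
  then show "balance_alloc f Y c i \<in> borel_measurable (restrict_space (reports i) (hist i))" .
  have vi: "(\<lambda>v. v i) \<in> borel_measurable (restrict_space (reports i) (hist i))"
    using i by (intro measurable_report) auto
  show "balance_payment k f Y c i \<in> borel_measurable (restrict_space (reports i) (hist i))"
  proof (cases "i < k")
    case True
    then have "balance_payment k f Y c i = (\<lambda>v. v i * balance_alloc f Y c i v)"
      by (simp add: fun_eq_iff balance_payment_def balance_alloc_def Let_def)
    then show ?thesis using x vi by simp
  next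
    case False
    then have "balance_payment k f Y c i = (\<lambda>v. balance_alloc f Y c i v * mean (prior f i) - bal c (i - 1) v)"
      by (simp add: fun_eq_iff balance_payment_def balance_alloc_def Let_def)
    then show ?thesis using x bm by simp
  qed
  fix v assume "v \<in> hist i"
  show "balance_alloc f Y c i v \<in> {0..1}"
    using optimizer_range[OF i] by (simp add: balance_alloc_def)
qed

abbreviation "bal_utility c \<equiv> utility (balance_alloc f Y c) (balance_payment k f Y c)"

text \<open>Before day \<open>k\<close> the payment takes the whole value; on day \<open>k\<close>
  the discount leaves exactly the final balance.\<close>

lemma bal_utility_eq:
  assumes i: "i \<in> {1..k}"
  shows "bal_utility c i v = (if i < k then 0 else bal c i v)"
proof -
  obtain j where j: "i = Suc j" using i by (cases i) auto
  show ?thesis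
    unfolding utility_def balance_payment_def balance_alloc_def Let_def j balance.simps diff_Suc_1
    by (cases "Suc j < k") (simp_all add: algebra_simps)
qed

lemma balance_IR: "0 \<le> c \<Longrightarrow> ex_post_IR k lo hi (balance_alloc f Y c) (balance_payment k f Y c)"
  using bal_utility_eq balance_nonneg unfolding ex_post_IR_def utility_def by force

text \<open>The balance is a martingale, because each report is centered at its mean. After day
  \<open>k\<close> nothing is left, since the final balance was already received on that
  day.\<close>

lemma balance_continuation:
  assumes c: "0 \<le> c" and "i \<le> k" "v \<in> hist i"
  shows "tail (cut (bal_utility c)) i v = (if i < k then ennreal (bal c i v) else 0)"
  using assms(2,3)
proof (induction i arbitrary: v rule: inc_induct)
  case base
  then show ?case by (simp add: tail_k)
next
  case (step i)
  then have i: "Suc i \<in> {1..k}" by auto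
  interpret value_dist "vals (Suc i)" "lo (Suc i)" "hi (Suc i)" by (rule value_dist_vals[OF i])
  have m: "measurable_policy (cut (bal_utility c))"
    by (intro measurable_policy_cut sales_utility_measurable(2)[OF balance_mechanism[OF c]])
  define b where "b = bal c i v"
  have b: "0 \<le> b" unfolding b_def using step by (intro balance_nonneg[OF c, of v i]) auto
  have "tail (cut (bal_utility c)) i v = (\<integral>\<^sup>+ y. cut (bal_utility c) (Suc i) (v(Suc i := y))
      + tail (cut (bal_utility c)) (Suc i) (v(Suc i := y)) \<partial>vals (Suc i))"
    using step by (intro tail_Suc m hist_extensional) auto
  also have "\<dots> = (\<integral>\<^sup>+ y. ennreal (b + Y (Suc i) b * (y - \<mu>)) \<partial>vals (Suc i))"
  proof (rule nn_integral_cong_AE)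
    show "AE y in vals (Suc i). cut (bal_utility c) (Suc i) (v(Suc i := y))
      + tail (cut (bal_utility c)) (Suc i) (v(Suc i := y)) = ennreal (b + Y (Suc i) b * (y - \<mu>))"
      using AE_in
    proof eventually_elim
      case (elim y)
      have h: "v(Suc i := y) \<in> hist (Suc i)" using step elim by (intro hist_Suc) auto
      then have "cut (bal_utility c) (Suc i) (v(Suc i := y))
          = (if Suc i < k then 0 else ennreal (bal c (Suc i) (v(Suc i := y))))"
        unfolding cut_def bal_utility_eq[OF i] by simp
      then show ?case
        unfolding step.IH[OF h] balance_Suc_upd[OF i] b_def by simp
    qed
  qed
  also have "\<dots> = ennreal (\<integral>y. b + Y (Suc i) b * (y - \<mu>) \<partial>vals (Suc i))"
    by (intro nn_integral_eq_integral integrable_shift eventually_mono[OF AE_in]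
        stage_feasible_balance optimizer_feasible[OF i b])
  also have "\<dots> = ennreal b" by (simp add: integral_shift)
  finally show ?case using step by (simp add: b_def)
qed

text \<open>Expected sales obey the recursion of \<open>val\<close>: day \<open>Suc i\<close> sells
  \<open>Y * y\<close>, of mean \<open>Y * \<mu>\<close>, and \<open>Y\<close> attains the stage
  maximum.\<close>

lemma balance_sales:
  assumes c: "0 \<le> c" and "i \<le> k" "v \<in> hist i"
  shows "tail (cut (sales (balance_alloc f Y c))) i v = ennreal (val (Suc i) (bal c i v))"
  using assms(2,3)
proof (induction i arbitrary: v rule: inc_induct)
  case base
  then show ?case by (simp add: tail_k val_last)
next
  case (step i)
  then have i: "Suc i \<in> {1..k}" by auto
  obtain K where K: "optimal_stage (vals (Suc i)) (lo (Suc i)) (hi (Suc i)) K (val (Suc (Suc i))) (Y (Suc i))"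
    using optimal_stage_day[OF i] by blast
  interpret optimal_stage "vals (Suc i)" "lo (Suc i)" "hi (Suc i)" K "val (Suc (Suc i))" "Y (Suc i)" by (rule K)
  let ?a = "cut (sales (balance_alloc f Y c))"
  have m: "measurable_policy ?a"
    by (intro measurable_policy_cut sales_utility_measurable(1)[OF balance_mechanism[OF c]])
  define b where "b = bal c i v"
  have b: "0 \<le> b" unfolding b_def using step by (intro balance_nonneg[OF c, of v i]) auto
  have Yb: "0 \<le> Y (Suc i) b" using optimizer_range[OF i] by simp
  have int: "integrable (vals (Suc i)) (\<lambda>y. val (Suc (Suc i)) (b + Y (Suc i) b * (y - \<mu>)))"
    by (rule integrable_stage[OF g])
  have "tail ?a i v = (\<integral>\<^sup>+ y. ?a (Suc i) (v(Suc i := y)) + tail ?a (Suc i) (v(Suc i := y)) \<partial>vals (Suc i))"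
    using step by (intro tail_Suc m hist_extensional) auto
  also have "\<dots> = (\<integral>\<^sup>+ y. ennreal (Y (Suc i) b * y + val (Suc (Suc i)) (b + Y (Suc i) b * (y - \<mu>))) \<partial>vals (Suc i))"
  proof (rule nn_integral_cong_AE)
    show "AE y in vals (Suc i). ?a (Suc i) (v(Suc i := y)) + tail ?a (Suc i) (v(Suc i := y))
        = ennreal (Y (Suc i) b * y + val (Suc (Suc i)) (b + Y (Suc i) b * (y - \<mu>)))"
      using AE_in
    proof eventually_elim
      case (elim y)
      have h: "v(Suc i := y) \<in> hist (Suc i)" using step elim by (intro hist_Suc) auto
      have "bal c i (v(Suc i := y)) = b" unfolding b_def by (rule balance_cong) auto
      then have "?a (Suc i) (v(Suc i := y)) = ennreal (Y (Suc i) b * y)"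
        using h by (simp add: cut_def sales_def balance_alloc_def mult.commute)
      moreover have "tail ?a (Suc i) (v(Suc i := y)) = ennreal (val (Suc (Suc i)) (b + Y (Suc i) b * (y - \<mu>)))"
        using step.IH[OF h] unfolding balance_Suc_upd[OF i] b_def .
      ultimately show ?case
        using elim lo_nonneg Yb stage_fun_nonneg[OF g] by simp
    qed
  qed
  also have "\<dots> = ennreal (\<integral>y. Y (Suc i) b * y + val (Suc (Suc i)) (b + Y (Suc i) b * (y - \<mu>)) \<partial>vals (Suc i))"
  proof (intro nn_integral_eq_integral Bochner_Integration.integrable_add int eventually_mono[OF AE_in])
    fix y assume "y \<in> {lo (Suc i)..hi (Suc i)}"
    then show "0 \<le> Y (Suc i) b * y + val (Suc (Suc i)) (b + Y (Suc i) b * (y - \<mu>))"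
      using lo_nonneg Yb stage_fun_nonneg[OF g] by (intro add_nonneg_nonneg) auto
  qed simp
  also have "(\<integral>y. Y (Suc i) b * y + val (Suc (Suc i)) (b + Y (Suc i) b * (y - \<mu>)) \<partial>vals (Suc i))
      = stage_value (val (Suc (Suc i))) b (Y (Suc i) b)"
    using int by (simp add: stage_value_def \<mu>_def mean_def)
  also have "\<dots> = val (Suc i) b" using val_eq[OF i b] by simp
  finally show ?case by (simp add: b_def)
qed

lemma hist_upd: "v \<in> hist i \<Longrightarrow> i \<in> {1..k} \<Longrightarrow> y \<in> {lo i..hi i} \<Longrightarrow> v(i := y) \<in> hist i"
  unfolding histories_def by (auto simp: PiE_def extensional_def Pi_iff)

text \<open>Truth-telling yields the balance after the day's report, which is affine in that report
  with slope the allocation. A misreport changes the balance and the day's value by opposite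
  amounts, so the buyer is indifferent among all reports.\<close>

lemma balance_feasible:
  assumes c: "0 \<le> c"
  shows "feasible k lo hi f (balance_alloc f Y c) (balance_payment k f Y c)"
  unfolding feasible_def
proof (intro conjI balance_mechanism[OF c] balance_IR[OF c])
  let ?x = "balance_alloc f Y c" and ?p = "balance_payment k f Y c"
  show "periodic_IC k lo hi f ?x ?p"
    unfolding periodic_IC_def
  proof (intro ballI)
    fix i v y assume i: "i \<in> {1..k}" and v: "v \<in> hist i" and y: "y \<in> {lo i..hi i}"
    obtain j where j: "i = Suc j" using i by (cases i) auto
    have v': "v(i := y) \<in> hist i" by (rule hist_upd[OF v i y])
    \<comment> \<open>For \<open>i < k\<close> the balance is all continuation; for
      \<open>i = k\<close> it is all paid on the day.\<close>
    have total: "ereal (u i * ?x i u - ?p i u) + continuation k f ?x ?p i u = ereal (bal c i u)"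
      if u: "u \<in> hist i" for u
    proof -
      have "0 \<le> bal c i u" using i by (intro balance_nonneg[OF c u]) auto
      moreover have "ereal (u i * ?x i u - ?p i u) = ereal (bal_utility c i u)" by (simp add: utility_def)
      ultimately show ?thesis
        using i unfolding continuation_eq[OF balance_IR[OF c] u] bal_utility_eq[OF i]
        by (subst balance_continuation[OF c _ u]) (auto simp: enn2ereal_ennreal zero_ennreal.rep_eq)
    qed
    have same: "bal c j (v(i := y)) = bal c j v" by (rule balance_cong) (auto simp: j)
    have x': "?x i (v(i := y)) = Y i (bal c j v)" using same by (simp add: balance_alloc_def j)
    have b: "bal c i v = Y i (bal c j v) * (v i - mean (prior f i)) + bal c j v"
      "bal c i (v(i := y)) = Y i (bal c j v) * (y - mean (prior f i)) + bal c j v"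
      using same by (simp_all add: j)
    have split: "v i * ?x i (v(i := y)) - ?p i (v(i := y))
      = (v i - y) * Y i (bal c j v) + ((v(i := y)) i * ?x i (v(i := y)) - ?p i (v(i := y)))"
      by (simp add: x' algebra_simps)
    have "ereal (v i * ?x i (v(i := y)) - ?p i (v(i := y))) + continuation k f ?x ?p i (v(i := y))
      = ereal ((v i - y) * Y i (bal c j v)) + (ereal ((v(i := y)) i * ?x i (v(i := y)) - ?p i (v(i := y)))
        + continuation k f ?x ?p i (v(i := y)))"
      unfolding split plus_ereal.simps(1)[symmetric] by (rule add.assoc)
    also have "\<dots> = ereal ((v i - y) * Y i (bal c j v)) + ereal (bal c i (v(i := y)))"
      by (simp only: total[OF v'])
    also have "\<dots> = ereal (bal c i v)" unfolding b by (simp add: algebra_simps)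
    finally show "ereal (v i * ?x i (v(i := y)) - ?p i (v(i := y))) + continuation k f ?x ?p i (v(i := y))
      \<le> ereal (v i * ?x i v - ?p i v) + continuation k f ?x ?p i v"
      by (simp only: total[OF v] order_refl)
  qed
qed

lemma balance_revenue:
  assumes c: "0 \<le> c" and k: "1 \<le> k"
  shows "revenue k f (balance_payment k f Y c) = ereal (val 1 c - c)"
proof -
  obtain K where "stage_fun K (val 1)" using val_stage_fun[of 1] k by auto
  then have "0 \<le> val 1 c" by (rule stage_fun_nonneg)
  then show ?thesis
    using revenue_eq[OF balance_mechanism[OF c] balance_IR[OF c]]
      balance_sales[OF c _ hist_0] balance_continuation[OF c _ hist_0] c k
    by (simp add: enn2ereal_ennreal)
qed

subsection \<open>Posted prices\<close>

lemma posted_feasible: "feasible k lo hi f (posted_alloc q) (posted_payment q)"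
  unfolding feasible_def
proof (intro conjI)
  show "is_mechanism k lo hi (posted_alloc q) (posted_payment q)"
    unfolding is_mechanism_def
  proof (intro ballI conjI)
    fix i assume "i \<in> {1..k}"
    then have [measurable]: "(\<lambda>v. v i) \<in> borel_measurable (restrict_space (reports i) (hist i))"
      by (intro measurable_report) auto
    show "posted_alloc q i \<in> borel_measurable (restrict_space (reports i) (hist i))"
      unfolding posted_alloc_def[abs_def] by measurable
    show "posted_payment q i \<in> borel_measurable (restrict_space (reports i) (hist i))"
      unfolding posted_payment_def[abs_def] by measurable
  qed (auto simp: posted_alloc_def)
  show "ex_post_IR k lo hi (posted_alloc q) (posted_payment q)"
    by (auto simp: ex_post_IR_def posted_alloc_def posted_payment_def)
  show "periodic_IC k lo hi f (posted_alloc q) (posted_payment q)"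
    unfolding periodic_IC_def
  proof (intro ballI add_mono)
    fix i v y assume "i \<in> {1..k}"
    show "ereal (v i * posted_alloc q i (v(i := y)) - posted_payment q i (v(i := y)))
      \<le> ereal (v i * posted_alloc q i v - posted_payment q i v)"
      by (auto simp: posted_alloc_def posted_payment_def)
    \<comment> \<open>Later days read only their own report, so the continuation ignores the report
      of day \<open>i\<close>.\<close>
    have "posted_alloc q j (restrict (continue i (v(i := y)) w) {1..j}) = posted_alloc q j (restrict (continue i v w) {1..j})"
      "posted_payment q j (restrict (continue i (v(i := y)) w) {1..j}) = posted_payment q j (restrict (continue i v w) {1..j})"
      if "j \<in> {i<..k}" for j w
      using that by (auto simp: posted_alloc_def posted_payment_def merge_def)
    then have "continuation k f (posted_alloc q) (posted_payment q) i (v(i := y))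
      = continuation k f (posted_alloc q) (posted_payment q) i v"
      unfolding continuation_def by (intro arg_cong2[where f = expect] ext refl arg_cong[where f = ereal] sum.cong) simp_all
    then show "continuation k f (posted_alloc q) (posted_payment q) i (v(i := y))
      \<le> continuation k f (posted_alloc q) (posted_payment q) i v" by simp
  qed
qed

lemma posted_revenue:
  "revenue k f (posted_payment q) = ereal (\<Sum>i\<in>{1..k}. q i * (1 - cdf (prior f i) (q i)))"
proof -
  interpret T: prob_space "PiM {1..k} vals" by (intro prob_space_PiM prob_space_vals)
  have day: "integrable (PiM {1..k} vals) (\<lambda>v. posted_payment q i (restrict v {1..i})) \<and>
    (\<integral>v. posted_payment q i (restrict v {1..i}) \<partial>PiM {1..k} vals) = q i * (1 - cdf (prior f i) (q i))"
    if i: "i \<in> {1..k}" for i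
  proof -
    interpret value_dist "vals i" "lo i" "hi i" by (rule value_dist_vals[OF i])
    define h where "h y = q i * indicator {q i..} y" for y :: real
    have h: "integrable (vals i) h" "integral\<^sup>L (vals i) h = q i * (1 - cdf (prior f i) (q i))"
    proof -
      show "integrable (vals i) h"
        by (rule integrable_bounded[of _ "\<bar>q i\<bar>"]) (auto simp: h_def[abs_def] indicator_def)
      have "vals i = prior f i" using i by (simp add: vals_def)
      then show "integral\<^sup>L (vals i) h = q i * (1 - cdf (prior f i) (q i))"
        unfolding h_def using prob_ge_eq_cdf[of "q i"] space_D by simp
    qed
    have d: "distr (PiM {1..k} vals) (vals i) (\<lambda>v. v i) = vals i"
      using i by (intro distr_PiM_component prob_space_vals)
    have c: "(\<lambda>v. v i) \<in> PiM {1..k} vals \<rightarrow>\<^sub>M vals i" using i by (intro measurable_component_singleton)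
    have eq: "posted_payment q i (restrict v {1..i}) = h (v i)" for v
      using i by (auto simp: posted_payment_def h_def)
    show ?thesis
      unfolding eq using h integrable_distr_eq[OF c, of h] integral_distr[OF c, of h] d by (simp add: borel_measurable_integrable)
  qed
  have "revenue k f (posted_payment q)
    = expect (PiM {1..k} vals) (\<lambda>v. ereal (\<Sum>i\<in>{1..k}. posted_payment q i (restrict v {1..i})))"
    unfolding revenue_def using PiM_prior[of "{1..k}"] by simp
  also have "\<dots> = ereal (\<integral>v. (\<Sum>i\<in>{1..k}. posted_payment q i (restrict v {1..i})) \<partial>PiM {1..k} vals)"
    using day by (intro expect_integrable Bochner_Integration.integrable_sum) blast
  also have "(\<integral>v. (\<Sum>i\<in>{1..k}. posted_payment q i (restrict v {1..i})) \<partial>PiM {1..k} vals)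
    = (\<Sum>i\<in>{1..k}. q i * (1 - cdf (prior f i) (q i)))"
    using day by (subst Bochner_Integration.integral_sum) auto
  finally show ?thesis .
qed

subsection \<open>Upper bound for feasible mechanisms\<close>

text \<open>An infinite continuation after one report would, by incentive compatibility, be infinite after
  every report of that day.\<close>

lemma tail_utility_finite:
  assumes feas: "feasible k lo hi f x p" and i: "i < k" and v: "v \<in> hist i"
    and fin: "tail (cut (utility x p)) i v < \<infinity>" and y: "y \<in> {lo (Suc i)..hi (Suc i)}"
  shows "tail (cut (utility x p)) (Suc i) (v(Suc i := y)) < \<infinity>"
proof (rule ccontr)
  let ?C = "\<lambda>y. tail (cut (utility x p)) (Suc i) (v(Suc i := y))"
  have m: "is_mechanism k lo hi x p" and ic: "periodic_IC k lo hi f x p" and ir: "ex_post_IR k lo hi x p"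
    using feas by (auto simp: feasible_def)
  have t: "Suc i \<in> {1..k}" using i by auto
  assume "\<not> ?C y < \<infinity>"
  then have Cy: "?C y = \<infinity>" by (cases "?C y") auto
  have Cz: "?C z = \<infinity>" if z: "z \<in> {lo (Suc i)..hi (Suc i)}" for z
  proof -
    have h: "v(Suc i := z) \<in> hist (Suc i)" "v(Suc i := y) \<in> hist (Suc i)"
      using v y z by (auto intro: hist_Suc)
    have eq: "(v(Suc i := z))(Suc i := y) = v(Suc i := y)" by simp
    have "ereal ((v(Suc i := z)) (Suc i) * x (Suc i) (v(Suc i := y)) - p (Suc i) (v(Suc i := y)))
        + continuation k f x p (Suc i) (v(Suc i := y))
      \<le> ereal ((v(Suc i := z)) (Suc i) * x (Suc i) (v(Suc i := z)) - p (Suc i) (v(Suc i := z)))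
        + continuation k f x p (Suc i) (v(Suc i := z))"
      using ic t h(1) y unfolding periodic_IC_def by (metis eq)
    then have "enn2ereal (?C z) = \<infinity>"
      unfolding continuation_eq[OF ir h(1)] continuation_eq[OF ir h(2)] Cy
      by (cases "enn2ereal (?C z)") auto
    then show ?thesis by (cases "?C z") (auto simp: enn2ereal_ennreal)
  qed
  have "tail (cut (utility x p)) i v
      = (\<integral>\<^sup>+ z. cut (utility x p) (Suc i) (v(Suc i := z)) + ?C z \<partial>vals (Suc i))"
    using sales_utility_measurable(2)[OF m] i v
    by (intro tail_Suc measurable_policy_cut hist_extensional) auto
  also have "\<dots> = (\<integral>\<^sup>+ z. \<infinity> \<partial>vals (Suc i))"
    using Cz by (intro nn_integral_cong_AE eventually_mono[OF AE_vals[OF t]]) auto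
  also have "\<dots> = \<infinity>"
    using prob_space.emeasure_space_1[OF prob_space_vals] by simp
  finally show False using fin by simp
qed

text \<open>Backward induction with the buyer's expected remaining utility as state.
  \<open>day_bound\<close> treats the current day, and finiteness of that utility is passed on by
  \<open>tail_utility_finite\<close>.\<close>

lemma tail_sales_le:
  assumes feas: "feasible k lo hi f x p"
    and R: "\<And>j r. j \<in> {1..k} \<Longrightarrow> r * (1 - cdf (prior f j) r) \<le> R j"
    and "i \<le> k" "v \<in> hist i" "tail (cut (utility x p)) i v < \<infinity>"
  shows "tail (cut (sales x)) i v
    \<le> ennreal (val (Suc i) (enn2real (tail (cut (utility x p)) i v)) + (\<Sum>j\<in>{i<..k}. R j))"
  using assms(3-5)
proof (induction i arbitrary: v rule: inc_induct)
  case base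
  then show ?case by (simp add: tail_k)
next
  case (step i)
  define t where "t = Suc i"
  have t: "t \<in> {1..k}" and i: "i < k" using step by (auto simp: t_def)
  have m: "is_mechanism k lo hi x p" and ic: "periodic_IC k lo hi f x p" and ir: "ex_post_IR k lo hi x p"
    using feas by (auto simp: feasible_def)
  have v: "v \<in> hist i" and fin: "tail (cut (utility x p)) i v < \<infinity>" using step by auto
  obtain K where K: "optimal_stage (vals t) (lo t) (hi t) K (val (Suc t)) (Y t)"
    using optimal_stage_day[OF t] by blast
  interpret optimal_stage "vals t" "lo t" "hi t" K "val (Suc t)" "Y t" by (rule K)
  define h where "h y = v(t := y)" for y
  define C where "C y = tail (cut (utility x p)) t (h y)" for y
  \<comment> \<open>Utility of the day plus continuation; \<open>enn2real\<close> loses nothing on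
    valid reports, where the sum is finite.\<close>
  define W where "W y = enn2real (cut (utility x p) t (h y) + C y)" for y
  define X where "X y = enn2real (cut x t (h y))" for y
  have pm: "measurable_policy (cut (utility x p))" "measurable_policy (cut (sales x))" "measurable_policy (cut x)"
    by (intro measurable_policy_cut sales_utility_measurable[OF m] is_mechanismD(1)[OF m]; assumption)+
  have hm: "h \<in> borel \<rightarrow>\<^sub>M reports t"
    unfolding h_def t_def by (intro measurable_append hist_extensional v)
  have [measurable]: "C \<in> borel_measurable borel"
    unfolding C_def by (rule measurable_compose[OF hm tail_measurable[OF pm(1)]])
  have [measurable]: "(\<lambda>y. cut (utility x p) t (h y)) \<in> borel_measurable borel" "(\<lambda>y. cut x t (h y)) \<in> borel_measurable borel"
    using pm t by (auto simp: measurable_policy_def intro!: measurable_compose[OF hm])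
  have [measurable]: "W \<in> borel_measurable borel" "X \<in> borel_measurable borel"
    unfolding W_def X_def by measurable
  have hist: "h y \<in> hist t" if "y \<in> {lo t..hi t}" for y
    using hist_Suc[OF v] that by (simp add: h_def t_def)
  have Cfin: "C y < \<infinity>" if "y \<in> {lo t..hi t}" for y
    using tail_utility_finite[OF feas i v fin] that by (simp add: C_def h_def t_def)
  have Xeq: "X y = x t (h y)" and Weq: "W y = utility x p t (h y) + enn2real (C y)"
    and Wenn: "ennreal (W y) = cut (utility x p) t (h y) + C y"
    if y: "y \<in> {lo t..hi t}" for y
  proof -
    show "X y = x t (h y)" using hist[OF y] is_mechanismD(3)[OF m t] by (simp add: X_def cut_def)
    obtain c where c: "C y = ennreal c" "0 \<le> c" using Cfin[OF y] by (cases "C y") auto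
    have u: "0 \<le> utility x p t (h y)" by (rule utility_nonneg[OF ir t hist[OF y]])
    have U: "cut (utility x p) t (h y) = ennreal (utility x p t (h y))" using hist[OF y] by (simp add: cut_def)
    have UC: "cut (utility x p) t (h y) + C y = ennreal (utility x p t (h y) + c)" using U c u by simp
    then show "W y = utility x p t (h y) + enn2real (C y)" "ennreal (W y) = cut (utility x p) t (h y) + C y"
      unfolding W_def UC using c u by (simp_all del: ennreal_plus)
  qed
  interpret day_mechanism "vals t" "lo t" "hi t" X W
  proof
    show "0 \<le> X y \<and> X y \<le> 1" if "y \<in> {lo t..hi t}" for y
      using is_mechanismD(3,4)[OF m t hist[OF that]] by (simp add: Xeq[OF that])
    show "0 \<le> W y" for y by (simp add: W_def)
    fix y y' assume y: "y \<in> {lo t..hi t}" and y': "y' \<in> {lo t..hi t}"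
    have cont: "continuation k f x p t (h z) = ereal (enn2real (C z))" if "z \<in> {lo t..hi t}" for z
      using continuation_eq[OF ir hist[OF that]] Cfin[OF that]
      by (cases "C z") (auto simp: C_def[symmetric] enn2ereal_ennreal)
    have hh: "(h y)(t := y') = h y'" "h y t = y" "h y' t = y'" by (auto simp: h_def)
    have "ereal (h y t * x t ((h y)(t := y')) - p t ((h y)(t := y'))) + continuation k f x p t ((h y)(t := y'))
      \<le> ereal (h y t * x t (h y) - p t (h y)) + continuation k f x p t (h y)"
      using ic t hist[OF y] y' unfolding periodic_IC_def by blast
    then show "W y' + (y - y') * X y' \<le> W y"
      unfolding hh cont[OF y] cont[OF y'] Weq[OF y] Weq[OF y'] Xeq[OF y'] utility_def
      by (simp add: algebra_simps)
  qed measurable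
  have tail_W: "tail (cut (utility x p)) i v = (\<integral>\<^sup>+ y. ennreal (W y) \<partial>vals t)"
  proof -
    have "tail (cut (utility x p)) i v = (\<integral>\<^sup>+ y. cut (utility x p) t (h y) + C y \<partial>vals t)"
      unfolding t_def h_def C_def by (intro tail_Suc pm i hist_extensional v)
    also have "\<dots> = (\<integral>\<^sup>+ y. ennreal (W y) \<partial>vals t)"
      by (intro nn_integral_cong_AE eventually_mono[OF AE_in]) (simp add: Wenn)
    finally show ?thesis .
  qed
  then have EW: "enn2real (tail (cut (utility x p)) i v) = (\<integral>y. W y \<partial>vals t)"
    by (subst integral_eq_nn_integral) (auto simp: W_def)
  have EW0: "0 \<le> integral\<^sup>L (vals t) W" unfolding EW[symmetric] by simp
  have vm: "mono (val (Suc t))" using g by (simp add: stage_fun_def)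
  have intg: "integrable (vals t) (\<lambda>y. val (Suc t) (W y))"
  proof (rule integrable_bounded)
    note stage_fun_measurable[OF g, measurable]
    show "(\<lambda>y. val (Suc t) (W y)) \<in> borel_measurable (vals t)" by measurable
    fix y assume y: "y \<in> {lo t..hi t}"
    have "W y \<le> W (lo t) + (hi t - lo t)" using W_bounds[OF y] y by auto
    from monoD[OF vm this] show "\<bar>val (Suc t) (W y)\<bar> \<le> val (Suc t) (W (lo t) + (hi t - lo t))"
      using stage_fun_nonneg[OF g, of "W y"] by simp
  qed
  define Q where "Q = (\<Sum>j\<in>{t<..k}. R j)"
  have R0: "0 \<le> R j" if "j \<in> {1..k}" for j using R[OF that, of 0] by simp
  have Q0: "0 \<le> Q" unfolding Q_def by (intro sum_nonneg R0) auto
  have sumR: "(\<Sum>j\<in>{i<..k}. R j) = R t + Q"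
  proof -
    have "{i<..k} = insert t {t<..k}" using t by (auto simp: t_def)
    then show ?thesis by (simp add: Q_def)
  qed
  have "tail (cut (sales x)) i v = (\<integral>\<^sup>+ y. cut (sales x) t (h y) + tail (cut (sales x)) t (h y) \<partial>vals t)"
    unfolding t_def h_def by (intro tail_Suc pm i hist_extensional v)
  also have "\<dots> \<le> (\<integral>\<^sup>+ y. ennreal (y * X y + val (Suc t) (W y) + Q) \<partial>vals t)"
  proof (intro nn_integral_mono_AE eventually_mono[OF AE_in])
    fix y assume y: "y \<in> {lo t..hi t}"
    have s: "cut (sales x) t (h y) = ennreal (y * X y)"
      using hist[OF y] by (simp add: cut_def sales_def Xeq[OF y]) (simp add: h_def)
    have "tail (cut (sales x)) t (h y) \<le> ennreal (val (Suc t) (enn2real (C y)) + Q)"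
      using step.IH[of "h y"] hist[OF y] Cfin[OF y] by (simp add: C_def Q_def t_def)
    \<comment> \<open>The induction hypothesis speaks of the continuation alone. Monotonicity of
      \<open>val\<close> adds the utility of the day, which ex-post rationality makes
      nonnegative.\<close>
    also have "\<dots> \<le> ennreal (val (Suc t) (W y) + Q)"
      using monoD[OF vm, of "enn2real (C y)" "W y"] utility_nonneg[OF ir t hist[OF y]]
      by (intro ennreal_leI) (simp add: Weq[OF y])
    finally have "cut (sales x) t (h y) + tail (cut (sales x)) t (h y) \<le> ennreal (y * X y) + ennreal (val (Suc t) (W y) + Q)"
      unfolding s by (rule add_left_mono)
    also have "\<dots> = ennreal (y * X y + (val (Suc t) (W y) + Q))"
      using x_range[OF y] y lo_nonneg Q0 stage_fun_nonneg[OF g, of "W y"] by (intro ennreal_plus[symmetric]) auto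
    finally show "cut (sales x) t (h y) + tail (cut (sales x)) t (h y) \<le> ennreal (y * X y + val (Suc t) (W y) + Q)"
      by (simp add: add.assoc)
  qed
  also have "\<dots> = ennreal (\<integral>y. y * X y + val (Suc t) (W y) + Q \<partial>vals t)"
  proof (intro nn_integral_eq_integral Bochner_Integration.integrable_add integrable_sales intg eventually_mono[OF AE_in])
    fix y assume y: "y \<in> {lo t..hi t}"
    then show "0 \<le> y * X y + val (Suc t) (W y) + Q"
      using x_range[OF y] lo_nonneg Q0 stage_fun_nonneg[OF g, of "W y"] by (intro add_nonneg_nonneg) auto
  qed simp
  also have "(\<integral>y. y * X y + val (Suc t) (W y) + Q \<partial>vals t)
      = (\<integral>y. y * X y \<partial>vals t) + (\<integral>y. val (Suc t) (W y) \<partial>vals t) + Q"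
    using intg integrable_sales by simp
  also have "\<dots> \<le> (R t + val t (integral\<^sup>L (vals t) W)) + Q"
  proof (intro add_right_mono day_bound[OF g])
    show "r * measure (vals t) {r..} \<le> R t" for r
      unfolding prob_ge_eq_cdf using R[OF t, of r] t by (simp add: vals_def)
    show "stage_value (val (Suc t)) (integral\<^sup>L (vals t) W) Z \<le> val t (integral\<^sup>L (vals t) W)"
      if "stage_feasible (integral\<^sup>L (vals t) W) Z" for Z
      using opt_best[OF that] val_eq[OF t EW0] by simp
  qed
  finally show ?case
    unfolding EW sumR by (simp add: t_def[symmetric] ennreal_leI add_ac)
qed

text \<open>With \<open>c\<close> the buyer's expected utility, revenue is sales minus
  \<open>c\<close>, so \<open>tail_sales_le\<close> leaves \<open>val 1 c - c\<close>. An infinite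
  utility makes the revenue -\<infinity>.\<close>

lemma optimal_revenue_le:
  assumes k: "1 \<le> k" and R: "\<And>j r. j \<in> {1..k} \<Longrightarrow> r * (1 - cdf (prior f j) r) \<le> R j"
    and B: "\<And>c. 0 \<le> c \<Longrightarrow> val 1 c - c \<le> B"
  shows "optimal_revenue k lo hi f \<le> ereal ((\<Sum>j\<in>{1..k}. R j) + B)"
  unfolding optimal_revenue_def
proof (rule SUP_least, clarify)
  fix x p assume feas: "feasible k lo hi f x p"
  then have m: "is_mechanism k lo hi x p" and ir: "ex_post_IR k lo hi x p" by (auto simp: feasible_def)
  let ?S = "tail (cut (sales x)) 0 start" and ?U = "tail (cut (utility x p)) 0 start"
  have days: "{0<..k} = {1..k}" by auto
  obtain s where s: "?S = ennreal s" "0 \<le> s" using tail_sales_finite[OF m hist_0] by (cases ?S) auto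
  have rev: "revenue k f p = ereal s - enn2ereal ?U"
    using revenue_eq[OF m ir] s by (simp add: enn2ereal_ennreal)
  show "revenue k f p \<le> ereal ((\<Sum>j\<in>{1..k}. R j) + B)"
  proof (cases "?U = \<infinity>")
    case True
    then show ?thesis by (simp add: rev)
  next
    case False
    then obtain c where c: "?U = ennreal c" "0 \<le> c" by (cases ?U) auto
    have "ennreal s \<le> ennreal (val 1 c + (\<Sum>j\<in>{1..k}. R j))"
      using tail_sales_le[OF feas R _ hist_0] c s by (simp add: days)
    moreover have "0 \<le> val 1 c + (\<Sum>j\<in>{1..k}. R j)"
    proof (intro add_nonneg_nonneg sum_nonneg)
      obtain K where "stage_fun K (val 1)" using val_stage_fun[of 1] k by auto
      then show "0 \<le> val 1 c" by (rule stage_fun_nonneg)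
      show "0 \<le> R j" if "j \<in> {1..k}" for j using R[OF that, of 0] by simp
    qed
    ultimately have "s \<le> val 1 c + (\<Sum>j\<in>{1..k}. R j)" by simp
    then show ?thesis using B[of c] c by (simp add: rev enn2ereal_ennreal)
  qed
qed

end

lemma value_dist_prior:
  assumes f: "f i \<in> borel_measurable borel" and "0 \<le> lo" "lo < hi"
    and p: "prob_space (prior f i)" and s: "measure_support (prior f i) = {lo..hi}"
  shows "value_dist (prior f i) lo hi"
proof -
  have "absolutely_continuous lborel (prior f i)"
    using f unfolding prior_def by (intro absolutely_continuousI_density) measurable
  then have "emeasure (prior f i) {x} = 0" for x
    unfolding absolutely_continuous_def by (auto simp: null_sets_def subset_eq)
  then show ?thesis
    using assms unfolding value_dist_def value_dist_axioms_def by (simp add: prior_def)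
qed

theorem theorem13:
  fixes k :: nat
    and lo hi :: "nat \<Rightarrow> real"
    and f :: "nat \<Rightarrow> real \<Rightarrow> real"
    and q :: "nat \<Rightarrow> real"
    and Y :: "nat \<Rightarrow> real \<Rightarrow> real"
    and c0 :: real
  assumes "k \<ge> 1"
    and "\<And>i. i \<in> {1..k} \<Longrightarrow> 0 \<le> lo i \<and> lo i < hi i"
    and "\<And>i. i \<in> {1..k} \<Longrightarrow> f i \<in> borel_measurable borel"
    and "\<And>i v. i \<in> {1..k} \<Longrightarrow> 0 \<le> f i v"
    and "\<And>i. i \<in> {1..k} \<Longrightarrow> prob_space (prior f i)"
    and "\<And>i. i \<in> {1..k} \<Longrightarrow> measure_support (prior f i) = {lo i..hi i}"
    and "\<And>i. i \<in> {1..k} \<Longrightarrow> is_monopoly_price (prior f i) (q i)"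
    and "\<And>i c. i \<in> {1..k} \<Longrightarrow> is_stage_optimizer k f i c (Y i c)"
    and "\<And>c. hhat k f 1 c - ereal c \<le> hhat k f 1 c0 - ereal c0"
  shows "feasible k lo hi f (posted_alloc q) (posted_payment q)
    \<and> feasible k lo hi f (balance_alloc f Y c0) (balance_payment k f Y c0)
    \<and> revenue k f (posted_payment q) / 2 + revenue k f (balance_payment k f Y c0) / 2
        \<ge> optimal_revenue k lo hi f / 2"
proof -
  interpret optimized_market k lo hi f Y
  proof (intro optimized_market.intro market.intro optimized_market_axioms.intro)
    show "value_dist (prior f i) (lo i) (hi i)" if "i \<in> {1..k}" for i
      using assms(2)[OF that] by (intro value_dist_prior assms(3,5,6) that) auto
  qed (rule assms(8))
  have hhat1: "hhat k f 1 c = (if c < 0 then - \<infinity> else ereal (val 1 c))" for c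
    using val_stage_fun[of 1] by simp
  obtain K where "stage_fun K (val 1)" using val_stage_fun[of 1] by auto
  then have "val 1 0 = 0" by (simp add: stage_fun_def)
  \<comment> \<open>A negative \<open>c0\<close> would have objective -\<infinity>, whereas the
    argument 0 has objective 0.\<close>
  then have c0: "0 \<le> c0"
    using assms(9)[of 0] unfolding hhat1 by (auto split: if_splits)
  define r where "r = (\<Sum>j\<in>{1..k}. q j * (1 - cdf (prior f j) (q j)))"
  have "optimal_revenue k lo hi f \<le> ereal (r + (val 1 c0 - c0))"
    unfolding r_def
  proof (intro optimal_revenue_le assms(1))
    show "s * (1 - cdf (prior f j) s) \<le> q j * (1 - cdf (prior f j) (q j))" if "j \<in> {1..k}" for j s
      using assms(7)[OF that] by (simp add: is_monopoly_price_def)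
    show "val 1 c - c \<le> val 1 c0 - c0" if "0 \<le> c" for c
      using assms(9)[of c] that c0 unfolding hhat1 by simp
  qed
  then have "optimal_revenue k lo hi f / 2 \<le> ereal (r + (val 1 c0 - c0)) / 2"
    by (rule ereal_divide_right_mono) simp
  also have "\<dots> = revenue k f (posted_payment q) / 2 + revenue k f (balance_payment k f Y c0) / 2"
    unfolding posted_revenue balance_revenue[OF c0 assms(1)] r_def[symmetric] by (simp add: add_divide_distrib)
  finally show ?thesis using posted_feasible balance_feasible[OF c0] by blast
qed

end
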